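(* Let $\Phi$ be a Young function, $K$ a locally compact hypergroup with a right Haar measure $m$, $w$ a weight on $K$, and $\eta:=(a_n)_{n\in\mathbb Z}$ an aperiodic sequence in $Z(K)$. If $w$ is densely $(\eta,\Phi)$-hypercyclic, then for every compact subset $E\subseteq K$ with $m(E)>0$ there exist a sequence $(E_k)_{k=1}^\infty$ of Borel subsets of $E$ and a strictly increasing sequence $(n_k)_{k=1}^\infty\subseteq\mathbb N$ such that $\lim_{k\to\infty}\|\chi_{E\setminus E_k}\|_\Phi=0$ and $$\lim_{k\to\infty}\|v_{n_k}^{-1}|_{E_k}\|_{\sup}=\lim_{k\to\infty}\|h_{n_k}|_{E_k}\|_{\sup}=0,$$ where for all $n\in\mathbb N$ and $x\in K$, $v_n(x):=w(x)\cdot w(xa_1^-)\cdots w(xa_n^-)$, $v_n^{-1}:=1/v_n$, and $h_n(x):=v_n(xa_n)$.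
   Context: **Hypergroups.** $\mathcal M(K)$ is the space of complex Radon measures on a locally compact Hausdorff space $K$, $\delta_x$ the point mass at $x$. A locally compact hypergroup is a non-empty locally compact Hausdorff space $K$ with a bilinear positive-continuous map $(\mu,\nu)\mapsto\mu\ast\nu$ on $\mathcal M(K)\times\mathcal M(K)$ into $\mathcal M(K)$ (convolution; positive-continuous means it maps pairs of non-negative measures to non-negative measures and is continuous on those in the cone topology) and an involutive homeomorphism $x\mapsto x^-$ of $K$ such that: (i) $(\mathcal M(K),+,\ast)$ is an associative algebra; (ii) each $\delta_x\ast\delta_y$ is a compactly supported probability measure; (iii) $(x,y)\mapsto\mathrm{supp}(\delta_x\ast\delta_y)$ is continuous into the space of non-empty compact subsets of $K$ with the Michael topology; (iv) there is $e\in K$ with $\delta_x\ast\delta_e=\delta_e\ast\delta_x=\delta_x$ for all $x$; (v) $e\in\mathrm{supp}(\delta_x\ast\delta_y)$ iff $x=y^-$; (vi) $(\delta_x\ast\delta_y)^-=\delta_{y^-}\ast\delta_{x^-}$, where $\mu^-$ is the image of $\mu$ under the involution. A right Haar measure is a non-zero non-negative Radon measure $m$ with $m\ast\delta_x=m$ for all $x\in K$, i.e. $\int f(y\ast x)\,dm(y)=\int f\,dm$ for $f\in C_c(K)$. For Borel $f$: $f(x\ast y):=\int_K f\,d(\delta_x\ast\delta_y)$ whenever the integral exists. For $A,B\subseteq K$, $A\ast B:=\bigcup_{x\in A,y\in B}\mathrm{supp}(\delta_x\ast\delta_y)$. $\chi_A$ is the characteristic function of $A$. The center is $Z(K):=\{x\in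 K:\delta_x\ast\delta_{x^-}=\delta_{x^-}\ast\delta_x=\delta_e\}$; for $z\in Z(K)$, $x\in K$, the set $\mathrm{supp}(\delta_x\ast\delta_z)$ is a singleton, whose element is written $xz$. **Orlicz spaces.** A Young function is a non-zero convex $\Phi:[0,\infty)\to[0,\infty]$ with $\Phi(0)=0$ and $\lim_{x\to\infty}\Phi(x)=\infty$; its complementary function is $\Psi(y)=\sup\{xy-\Phi(x):x\ge0\}$. It is assumed that $\Psi$ is increasing. $L^\Phi(K)$ is the set of Borel measurable $f:K\to\mathbb C$ with $\int_K\Phi(\alpha|f|)\,dm<\infty$ for some $\alpha>0$ (modulo $m$-a.e. equality), a Banach space under $\|f\|_\Phi:=\sup\{\int_K|fv|\,dm: v \text{ Borel},\ \int_K\Psi(|v|)\,dm\le1\}$. For a function $g$ on $K$ and $A\subseteq K$, $\|g|_A\|_{\sup}:=\sup_{x\in A}|g(x)|$ (equal to $0$ if $A=\varnothing$). **Weights and operators.** A weight on $K$ is a bounded continuous function $w:K\to(0,\infty)$. For a sequence $\eta=(a_n)_{n\in\mathbb Z}$ in $K$ and $n\in\mathbb N$, $\Lambda_n f(x):=w(x)\,w(x\ast a_{-1})\cdots w(x\ast a_{-n})\,f(x\ast a_{-n})$ for $f\in L^\Phi(K)$. **Aperiodic sequence.** $\eta=(a_n)_{n\in\mathbb Z}$ is aperiodic if (1) $a_0=e$ and $a_{-n}=a_n^-$ for all $n\in\mathbb N$; (2) for every compact $E\subseteq K$ with $m(E)>0$ there is $N>0$ such that $E\cap(E\ast\{a_n\})=\varnothing$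 and $E\cap(E\ast\{a_{-n}\})=\varnothing$ for all $n\ge N$. **Hypercyclic weights.** A vector $f\in L^\Phi(K)$ is a hypercyclic vector for $w$ if $\{f,\Lambda_1f,\Lambda_2f,\dots\}$ is dense in $L^\Phi(K)$; $w$ is $(\eta,\Phi)$-hypercyclic if such an $f$ exists, and densely $(\eta,\Phi)$-hypercyclic if moreover the set of hypercyclic vectors is dense in $L^\Phi(K)$. *)

theory Defs
  imports "HOL-Analysis.Analysis"
begin

section \<open>Radon measures on a Hausdorff space\<close>

definition radon_measure :: "'a::t2_space measure \<Rightarrow> bool" where
  "radon_measure m \<longleftrightarrow>
     sets m = sets borel \<and>
     (\<forall>C. compact C \<longrightarrow> emeasure m C < \<infinity>) \<and>
     (\<forall>A\<in>sets borel. emeasure m A = (INF U\<in>{U. open U \<and> A \<subseteq> U}. emeasure m U)) \<and>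
     (\<forall>U. open U \<longrightarrow> emeasure m U = (SUP C\<in>{C. compact C \<and> C \<subseteq> U}. emeasure m C))"

text \<open>A complex measure is a set function on the Borel sets. It is extended by \<open>0\<close> to all other
  sets, so that equality of complex measures is equality of functions.\<close>

definition complex_borel_measure :: "('a::topological_space set \<Rightarrow> complex) \<Rightarrow> bool" where
  "complex_borel_measure \<mu> \<longleftrightarrow>
     (\<forall>A. A \<notin> sets borel \<longrightarrow> \<mu> A = 0) \<and>
     (\<forall>A :: nat \<Rightarrow> 'a set. range A \<subseteq> sets borel \<longrightarrow> disjoint_family A \<longrightarrow>
        (\<lambda>i. \<mu> (A i)) sums \<mu> (\<Union>i. A i))"

definition total_variation :: "('a::topological_space set \<Rightarrow> complex) \<Rightarrow> 'a set \<Rightarrow> ennreal" where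
  "total_variation \<mu> A =
     (SUP P\<in>{P. finite P \<and> disjoint P \<and> P \<subseteq> sets borel \<and> \<Union>P = A}. \<Sum>B\<in>P. ennreal (cmod (\<mu> B)))"

definition complex_radon_measures :: "('a::t2_space set \<Rightarrow> complex) set" where
  "complex_radon_measures =
     {\<mu>. complex_borel_measure \<mu> \<and>
          radon_measure (measure_of UNIV (sets borel) (total_variation \<mu>))}"

definition nonneg_radon_measures :: "('a::t2_space set \<Rightarrow> complex) set" where
  "nonneg_radon_measures = {\<mu> \<in> complex_radon_measures. \<forall>A. \<mu> A \<in> \<real>\<^sub>\<ge>\<^sub>0}"

text \<open>The measure in the sense of HOL-Analysis that belongs to a non-negative \<open>\<mu>\<close>.\<close>

definition to_measure :: "('a::topological_space set \<Rightarrow> complex) \<Rightarrow> 'a measure" where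
  "to_measure \<mu> = measure_of UNIV (sets borel) (\<lambda>A. ennreal (Re (\<mu> A)))"

definition point_mass :: "'a::topological_space \<Rightarrow> 'a set \<Rightarrow> complex" where
  "point_mass x A = (if A \<in> sets borel \<and> x \<in> A then 1 else 0)"

definition supp :: "('a::topological_space set \<Rightarrow> complex) \<Rightarrow> 'a set" where
  "supp \<mu> = {x. \<forall>U. open U \<longrightarrow> x \<in> U \<longrightarrow> total_variation \<mu> U \<noteq> 0}"

definition Cc :: "('a::topological_space \<Rightarrow> 'b::real_normed_vector) set" where
  "Cc = {f. continuous_on UNIV f \<and> compact (closure {x. f x \<noteq> 0})}"

text \<open>The cone topology is the weakest topology on the non-negative measures for which
  \<open>\<mu> \<mapsto> \<integral> f d\<mu>\<close> is continuous for every non-negative \<open>f\<close> in \<open>Cc\<close> and for \<open>f = 1\<close>.\<close>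

definition cone_topology :: "('a::t2_space set \<Rightarrow> complex) topology" where
  "cone_topology = topology_generated_by
     {{\<mu> \<in> nonneg_radon_measures. (LINT x|to_measure \<mu>. f x) \<in> V} | (f :: 'a \<Rightarrow> real) V.
        open V \<and> (f \<in> Cc \<and> (\<forall>x. 0 \<le> f x) \<or> f = (\<lambda>x. 1))}"

definition michael_topology :: "'a::t2_space set topology" where
  "michael_topology = topology_generated_by
     {{C. compact C \<and> C \<noteq> {} \<and> C \<inter> U \<noteq> {} \<and> C \<subseteq> V} | U V. open U \<and> open V}"


section \<open>Hypergroups\<close>

locale hypergroup =
  fixes conv :: "('a::t2_space set \<Rightarrow> complex) \<Rightarrow> ('a set \<Rightarrow> complex) \<Rightarrow> 'a set \<Rightarrow> complex"
    and invol :: "'a \<Rightarrow> 'a"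
    and e :: 'a
  assumes locally_compact: "locally_compact_space (euclidean :: 'a topology)"
    and conv_closed: "\<lbrakk>\<mu> \<in> complex_radon_measures; \<nu> \<in> complex_radon_measures\<rbrakk>
          \<Longrightarrow> conv \<mu> \<nu> \<in> complex_radon_measures"
    and conv_add_left: "\<lbrakk>\<mu> \<in> complex_radon_measures; \<mu>' \<in> complex_radon_measures;
          \<nu> \<in> complex_radon_measures\<rbrakk>
          \<Longrightarrow> conv (\<lambda>A. \<mu> A + \<mu>' A) \<nu> = (\<lambda>A. conv \<mu> \<nu> A + conv \<mu>' \<nu> A)"
    and conv_add_right: "\<lbrakk>\<mu> \<in> complex_radon_measures; \<nu> \<in> complex_radon_measures;
          \<nu>' \<in> complex_radon_measures\<rbrakk>
          \<Longrightarrow> conv \<mu> (\<lambda>A. \<nu> A + \<nu>' A) = (\<lambda>A. conv \<mu> \<nu> A + conv \<mu> \<nu>' A)"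
    and conv_scale_left: "\<lbrakk>\<mu> \<in> complex_radon_measures; \<nu> \<in> complex_radon_measures\<rbrakk>
          \<Longrightarrow> conv (\<lambda>A. c * \<mu> A) \<nu> = (\<lambda>A. c * conv \<mu> \<nu> A)"
    and conv_scale_right: "\<lbrakk>\<mu> \<in> complex_radon_measures; \<nu> \<in> complex_radon_measures\<rbrakk>
          \<Longrightarrow> conv \<mu> (\<lambda>A. c * \<nu> A) = (\<lambda>A. c * conv \<mu> \<nu> A)"
    and conv_nonneg: "\<lbrakk>\<mu> \<in> nonneg_radon_measures; \<nu> \<in> nonneg_radon_measures\<rbrakk>
          \<Longrightarrow> conv \<mu> \<nu> \<in> nonneg_radon_measures"
    and conv_continuous: "continuous_map (prod_topology cone_topology cone_topology) cone_topology
          (\<lambda>(\<mu>, \<nu>). conv \<mu> \<nu>)"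
    and conv_assoc: "\<lbrakk>\<mu> \<in> complex_radon_measures; \<nu> \<in> complex_radon_measures;
          \<rho> \<in> complex_radon_measures\<rbrakk> \<Longrightarrow> conv (conv \<mu> \<nu>) \<rho> = conv \<mu> (conv \<nu> \<rho>)"
    and invol_invol: "invol (invol x) = x"
    and invol_continuous: "continuous_on UNIV invol"
    and point_conv_prob: "conv (point_mass x) (point_mass y) \<in> nonneg_radon_measures"
          "conv (point_mass x) (point_mass y) UNIV = 1"
    and point_conv_compact_supp: "compact (supp (conv (point_mass x) (point_mass y)))"
    and supp_continuous: "continuous_map (euclidean :: ('a \<times> 'a) topology) michael_topology
          (\<lambda>(x, y). supp (conv (point_mass x) (point_mass y)))"
    and unit: "conv (point_mass x) (point_mass e) = point_mass x"
          "conv (point_mass e) (point_mass x) = point_mass x"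
    and unit_in_supp_iff: "e \<in> supp (conv (point_mass x) (point_mass y)) \<longleftrightarrow> x = invol y"
    and invol_conv: "(\<lambda>A. conv (point_mass x) (point_mass y) (invol -` A)) =
          conv (point_mass (invol y)) (point_mass (invol x))"

text \<open>In the following definitions \<open>conv\<close> is the convolution of a hypergroup.
  \<open>hg_eval conv f x y\<close> is \<open>f (x * y)\<close>, the integral of \<open>f\<close> over \<open>\<delta>\<^sub>x * \<delta>\<^sub>y\<close>.\<close>

definition hg_eval ::
  "(('a::t2_space set \<Rightarrow> complex) \<Rightarrow> ('a set \<Rightarrow> complex) \<Rightarrow> 'a set \<Rightarrow> complex) \<Rightarrow>
   ('a \<Rightarrow> 'b::{banach,second_countable_topology}) \<Rightarrow> 'a \<Rightarrow> 'a \<Rightarrow> 'b" where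
  "hg_eval conv f x y = (LINT u|to_measure (conv (point_mass x) (point_mass y)). f u)"

definition hg_set_mult ::
  "(('a::t2_space set \<Rightarrow> complex) \<Rightarrow> ('a set \<Rightarrow> complex) \<Rightarrow> 'a set \<Rightarrow> complex) \<Rightarrow>
   'a set \<Rightarrow> 'a set \<Rightarrow> 'a set" where
  "hg_set_mult conv A B = (\<Union>x\<in>A. \<Union>y\<in>B. supp (conv (point_mass x) (point_mass y)))"

definition hg_center ::
  "(('a::t2_space set \<Rightarrow> complex) \<Rightarrow> ('a set \<Rightarrow> complex) \<Rightarrow> 'a set \<Rightarrow> complex) \<Rightarrow>
   ('a \<Rightarrow> 'a) \<Rightarrow> 'a \<Rightarrow> 'a set" where
  "hg_center conv invol e =
     {x. conv (point_mass x) (point_mass (invol x)) = point_mass e \<and>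
         conv (point_mass (invol x)) (point_mass x) = point_mass e}"

text \<open>The element \<open>xz\<close>, for \<open>z\<close> in the center.\<close>

definition hg_mult ::
  "(('a::t2_space set \<Rightarrow> complex) \<Rightarrow> ('a set \<Rightarrow> complex) \<Rightarrow> 'a set \<Rightarrow> complex) \<Rightarrow>
   'a \<Rightarrow> 'a \<Rightarrow> 'a" where
  "hg_mult conv x z = the_elem (supp (conv (point_mass x) (point_mass z)))"

definition right_haar_measure ::
  "(('a::t2_space set \<Rightarrow> complex) \<Rightarrow> ('a set \<Rightarrow> complex) \<Rightarrow> 'a set \<Rightarrow> complex) \<Rightarrow>
   'a measure \<Rightarrow> bool" where
  "right_haar_measure conv m \<longleftrightarrow>
     radon_measure m \<and> emeasure m UNIV \<noteq> 0 \<and>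
     (\<forall>x. \<forall>f :: 'a \<Rightarrow> complex. f \<in> Cc \<longrightarrow> (LINT y|m. hg_eval conv f y x) = (LINT y|m. f y))"


section \<open>Orlicz spaces\<close>

text \<open>Only the values of a Young function on \<open>{0..}\<close> matter.\<close>

definition young_function :: "(real \<Rightarrow> ennreal) \<Rightarrow> bool" where
  "young_function \<Phi> \<longleftrightarrow>
     (\<exists>x\<ge>0. \<Phi> x \<noteq> 0) \<and>
     (\<forall>x\<ge>0. \<forall>y\<ge>0. \<forall>t\<in>{0..1}.
        \<Phi> (t * x + (1 - t) * y) \<le> ennreal t * \<Phi> x + ennreal (1 - t) * \<Phi> y) \<and>
     \<Phi> 0 = 0 \<and> (\<Phi> \<longlongrightarrow> \<infinity>) at_top"

definition complementary :: "(real \<Rightarrow> ennreal) \<Rightarrow> real \<Rightarrow> ennreal" where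
  "complementary \<Phi> y = e2ennreal (SUP x\<in>{0..}. ereal (x * y) - enn2ereal (\<Phi> x))"

text \<open>The complementary function of a Young function is always nondecreasing. It is constant only
  if \<open>\<Phi>\<close> is infinite on all of \<open>{0<..}\<close>, in which case the Orlicz space is trivial.\<close>

definition increasing_complementary :: "(real \<Rightarrow> ennreal) \<Rightarrow> bool" where
  "increasing_complementary \<Phi> \<longleftrightarrow>
     mono_on {0..} (complementary \<Phi>) \<and> \<not> complementary \<Phi> constant_on {0..}"

text \<open>Functions are not identified modulo null sets: the Orlicz norm is then a seminorm, and
  density is density with respect to this seminorm.\<close>

definition orlicz_space ::
  "(real \<Rightarrow> ennreal) \<Rightarrow> 'a::topological_space measure \<Rightarrow> ('a \<Rightarrow> complex) set" where
  "orlicz_space \<Phi> m =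
     {f \<in> borel_measurable borel. \<exists>\<alpha>>0. (\<integral>\<^sup>+x. \<Phi> (\<alpha> * cmod (f x)) \<partial>m) < \<infinity>}"

definition orlicz_norm ::
  "(real \<Rightarrow> ennreal) \<Rightarrow> 'a::topological_space measure \<Rightarrow> ('a \<Rightarrow> complex) \<Rightarrow> ennreal" where
  "orlicz_norm \<Phi> m f =
     (SUP v\<in>{v \<in> borel_measurable borel. (\<integral>\<^sup>+x. complementary \<Phi> (cmod (v x)) \<partial>m) \<le> 1}.
        \<integral>\<^sup>+x. ennreal (cmod (f x * v x)) \<partial>m)"

definition orlicz_dense ::
  "(real \<Rightarrow> ennreal) \<Rightarrow> 'a::topological_space measure \<Rightarrow> ('a \<Rightarrow> complex) set \<Rightarrow> bool" where
  "orlicz_dense \<Phi> m D \<longleftrightarrow>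
     D \<subseteq> orlicz_space \<Phi> m \<and>
     (\<forall>g\<in>orlicz_space \<Phi> m. \<forall>\<epsilon>>0. \<exists>f\<in>D. orlicz_norm \<Phi> m (\<lambda>x. f x - g x) < \<epsilon>)"


section \<open>Weights, aperiodic sequences, hypercyclicity\<close>

definition hg_weight :: "('a::topological_space \<Rightarrow> real) \<Rightarrow> bool" where
  "hg_weight w \<longleftrightarrow> continuous_on UNIV w \<and> bounded (range w) \<and> (\<forall>x. 0 < w x)"

definition Lambda ::
  "(('a::t2_space set \<Rightarrow> complex) \<Rightarrow> ('a set \<Rightarrow> complex) \<Rightarrow> 'a set \<Rightarrow> complex) \<Rightarrow>
   ('a \<Rightarrow> real) \<Rightarrow> (int \<Rightarrow> 'a) \<Rightarrow> nat \<Rightarrow> ('a \<Rightarrow> complex) \<Rightarrow> 'a \<Rightarrow> complex" where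
  "Lambda conv w a n f x =
     complex_of_real (w x * (\<Prod>j=1..n. hg_eval conv w x (a (- int j)))) *
     hg_eval conv f x (a (- int n))"

definition aperiodic ::
  "(('a::t2_space set \<Rightarrow> complex) \<Rightarrow> ('a set \<Rightarrow> complex) \<Rightarrow> 'a set \<Rightarrow> complex) \<Rightarrow>
   ('a \<Rightarrow> 'a) \<Rightarrow> 'a \<Rightarrow> 'a measure \<Rightarrow> (int \<Rightarrow> 'a) \<Rightarrow> bool" where
  "aperiodic conv invol e m a \<longleftrightarrow>
     a 0 = e \<and> (\<forall>n::nat. a (- int n) = invol (a (int n))) \<and>
     (\<forall>E. compact E \<and> emeasure m E > 0 \<longrightarrow>
        (\<exists>N>0. \<forall>n::nat. n \<ge> N \<longrightarrow>
           E \<inter> hg_set_mult conv E {a (int n)} = {} \<and>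
           E \<inter> hg_set_mult conv E {a (- int n)} = {}))"

definition hypercyclic_vector ::
  "(('a::t2_space set \<Rightarrow> complex) \<Rightarrow> ('a set \<Rightarrow> complex) \<Rightarrow> 'a set \<Rightarrow> complex) \<Rightarrow>
   'a measure \<Rightarrow> (int \<Rightarrow> 'a) \<Rightarrow> (real \<Rightarrow> ennreal) \<Rightarrow> ('a \<Rightarrow> real) \<Rightarrow> ('a \<Rightarrow> complex) \<Rightarrow> bool" where
  "hypercyclic_vector conv m a \<Phi> w f \<longleftrightarrow>
     f \<in> orlicz_space \<Phi> m \<and>
     orlicz_dense \<Phi> m (insert f {Lambda conv w a n f | n. n \<ge> 1})"

definition hypercyclic_weight ::
  "(('a::t2_space set \<Rightarrow> complex) \<Rightarrow> ('a set \<Rightarrow> complex) \<Rightarrow> 'a set \<Rightarrow> complex) \<Rightarrow>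
   'a measure \<Rightarrow> (int \<Rightarrow> 'a) \<Rightarrow> (real \<Rightarrow> ennreal) \<Rightarrow> ('a \<Rightarrow> real) \<Rightarrow> bool" where
  "hypercyclic_weight conv m a \<Phi> w \<longleftrightarrow> (\<exists>f. hypercyclic_vector conv m a \<Phi> w f)"

definition densely_hypercyclic_weight ::
  "(('a::t2_space set \<Rightarrow> complex) \<Rightarrow> ('a set \<Rightarrow> complex) \<Rightarrow> 'a set \<Rightarrow> complex) \<Rightarrow>
   'a measure \<Rightarrow> (int \<Rightarrow> 'a) \<Rightarrow> (real \<Rightarrow> ennreal) \<Rightarrow> ('a \<Rightarrow> real) \<Rightarrow> bool" where
  "densely_hypercyclic_weight conv m a \<Phi> w \<longleftrightarrow>
     hypercyclic_weight conv m a \<Phi> w \<and>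
     orlicz_dense \<Phi> m {f. hypercyclic_vector conv m a \<Phi> w f}"

definition weight_prod ::
  "(('a::t2_space set \<Rightarrow> complex) \<Rightarrow> ('a set \<Rightarrow> complex) \<Rightarrow> 'a set \<Rightarrow> complex) \<Rightarrow>
   ('a \<Rightarrow> 'a) \<Rightarrow> ('a \<Rightarrow> real) \<Rightarrow> (int \<Rightarrow> 'a) \<Rightarrow> nat \<Rightarrow> 'a \<Rightarrow> real" where
  "weight_prod conv invol w a n x =
     w x * (\<Prod>j=1..n. w (hg_mult conv x (invol (a (int j)))))"

definition weight_prod_shift ::
  "(('a::t2_space set \<Rightarrow> complex) \<Rightarrow> ('a set \<Rightarrow> complex) \<Rightarrow> 'a set \<Rightarrow> complex) \<Rightarrow>
   ('a \<Rightarrow> 'a) \<Rightarrow> ('a \<Rightarrow> real) \<Rightarrow> (int \<Rightarrow> 'a) \<Rightarrow> nat \<Rightarrow> 'a \<Rightarrow> real" where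
  "weight_prod_shift conv invol w a n x =
     weight_prod conv invol w a n (hg_mult conv x (a (int n)))"

text \<open>The supremum is taken in \<open>ennreal\<close>, so it is \<open>0\<close> on the empty set.\<close>

definition sup_norm_on :: "'a set \<Rightarrow> ('a \<Rightarrow> real) \<Rightarrow> ennreal" where
  "sup_norm_on A g = (SUP x\<in>A. ennreal \<bar>g x\<bar>)"

end

theory Submission
  imports Defs "HOL-Probability.Giry_Monad"
begin

text \<open>
  For central \<open>z\<close> the product \<open>\<delta>\<^sub>x * \<delta>\<^sub>z\<close> is a point mass: if \<open>u\<close> is in its support, then by
  continuity \<open>\<delta>\<^sub>u\<close> times the point mass at \<open>z\<^sup>-\<close> is \<open>\<delta>\<^sub>x\<close>, and multiplying by \<open>\<delta>\<^sub>z\<close> gives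
  \<open>\<delta>\<^sub>u = \<delta>\<^sub>x * \<delta>\<^sub>z\<close>. So right translation by \<open>z\<close> is a homeomorphism; it preserves \<open>m\<close>, and hence the
  Orlicz norm. Choose a hypercyclic vector \<open>f\<close> close to \<open>\<chi>\<^sub>E\<close> and a large \<open>n\<close> with \<open>\<Lambda>\<^sub>n f\<close> also close
  to \<open>\<chi>\<^sub>E\<close>. The functions \<open>f - \<chi>\<^sub>E\<close> and \<open>\<Lambda>\<^sub>n f - \<chi>\<^sub>E\<close> and their translates by \<open>a\<^sub>n\<^sup>-\<close> and \<open>a\<^sub>n\<close> are
  uniformly small off a set whose indicator has small norm. By aperiodicity \<open>x a\<^sub>n\<close> and \<open>x a\<^sub>n\<^sup>-\<close>
  lie outside \<open>E\<close> for \<open>x \<in> E\<close>. Off the exceptional set, \<open>\<Lambda>\<^sub>n f(x) = v\<^sub>n(x) f(x a\<^sub>n\<^sup>-)\<close> is close to \<open>1\<close>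
  while \<open>f(x a\<^sub>n\<^sup>-)\<close> is close to \<open>0\<close>, so \<open>v\<^sub>n(x)\<close> is large; and \<open>\<Lambda>\<^sub>n f(x a\<^sub>n) = h\<^sub>n(x) f(x)\<close> is close
  to \<open>0\<close> while \<open>f(x)\<close> is close to \<open>1\<close>, so \<open>h\<^sub>n(x)\<close> is small.
\<close>

section \<open>Radon measures\<close>

lemma sets_radon_measure: "radon_measure M \<Longrightarrow> sets M = sets borel"
  unfolding radon_measure_def by (rule conjunct1)

text \<open>The regularity equations loop as rewrite rules, hence the explicit projections.\<close>

lemma emeasure_radon_measure_compact:
  assumes "radon_measure M" and "compact C"
  shows "emeasure M C < \<infinity>"
  using assms(2)
  by (rule assms(1)[unfolded radon_measure_def, THEN conjunct2, THEN conjunct1, THEN spec, THEN mp])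

lemma emeasure_radon_measure_outer:
  assumes "radon_measure M" and "A \<in> sets borel"
  shows "emeasure M A = (INF U\<in>{U. open U \<and> A \<subseteq> U}. emeasure M U)"
  using assms(2)
  by (rule assms(1)[unfolded radon_measure_def, THEN conjunct2, THEN conjunct2, THEN conjunct1,
        THEN bspec])

lemma emeasure_radon_measure_inner:
  assumes "radon_measure M" and "open U"
  shows "emeasure M U = (SUP C\<in>{C. compact C \<and> C \<subseteq> U}. emeasure M C)"
  using assms(2)
  by (rule assms(1)[unfolded radon_measure_def, THEN conjunct2, THEN conjunct2, THEN conjunct2,
        THEN spec, THEN mp])

lemma space_eq_UNIV_of_sets_borel:
  "sets M = sets (borel :: 'a::topological_space measure) \<Longrightarrow> space M = UNIV"
  by (drule sets_eq_imp_space_eq) simp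

lemma INF_ennreal_le_iff:
  assumes "0 \<le> a" and "\<And>i. i \<in> I \<Longrightarrow> 0 \<le> b i"
  shows "(INF i\<in>I. ennreal (b i)) \<le> ennreal a \<longleftrightarrow> (\<forall>\<epsilon>>0. \<exists>i\<in>I. b i < a + \<epsilon>)"
proof (intro iffI allI impI)
  fix \<epsilon> :: real assume "(INF i\<in>I. ennreal (b i)) \<le> ennreal a" and "0 < \<epsilon>"
  note this(1)
  also have "ennreal a < ennreal (a + \<epsilon>)"
    using assms(1) \<open>0 < \<epsilon>\<close> by (simp add: ennreal_less_iff)
  finally obtain i where "i \<in> I" "ennreal (b i) < ennreal (a + \<epsilon>)"
    unfolding INF_less_iff by blast
  then show "\<exists>i\<in>I. b i < a + \<epsilon>"
    using assms(2) by (intro bexI[of _ i]) (simp_all add: ennreal_less_iff)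
next
  assume approx: "\<forall>\<epsilon>>0. \<exists>i\<in>I. b i < a + \<epsilon>"
  show "(INF i\<in>I. ennreal (b i)) \<le> ennreal a"
  proof (rule ennreal_le_epsilon)
    fix \<epsilon> :: real assume "0 < \<epsilon>"
    with approx obtain i where "i \<in> I" "b i < a + \<epsilon>" by blast
    then have "(INF i\<in>I. ennreal (b i)) \<le> ennreal (a + \<epsilon>)"
      by (intro INF_lower2[of i] ennreal_leI) auto
    then show "(INF i\<in>I. ennreal (b i)) \<le> ennreal a + ennreal \<epsilon>"
      using assms(1) \<open>0 < \<epsilon>\<close> by simp
  qed
qed

lemma ennreal_le_SUP_iff:
  assumes "I \<noteq> {}" and "\<And>i. i \<in> I \<Longrightarrow> 0 \<le> b i"
  shows "ennreal a \<le> (SUP i\<in>I. ennreal (b i)) \<longleftrightarrow> (\<forall>\<epsilon>>0. \<exists>i\<in>I. a < b i + \<epsilon>)"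
proof (intro iffI allI impI)
  fix \<epsilon> :: real assume below: "ennreal a \<le> (SUP i\<in>I. ennreal (b i))" and "0 < \<epsilon>"
  show "\<exists>i\<in>I. a < b i + \<epsilon>"
  proof (cases "a < \<epsilon>")
    case True
    moreover obtain i where "i \<in> I" using assms(1) by blast
    ultimately show ?thesis using assms(2)[of i] by (intro bexI[of _ i]) auto
  next
    case False
    with \<open>0 < \<epsilon>\<close> have "ennreal (a - \<epsilon>) < ennreal a" by (simp add: ennreal_less_iff)
    also note below
    finally obtain i where "i \<in> I" "ennreal (a - \<epsilon>) < ennreal (b i)"
      unfolding less_SUP_iff by blast
    with False show ?thesis by (intro bexI[of _ i]) (simp_all add: ennreal_less_iff)
  qed
next
  assume approx: "\<forall>\<epsilon>>0. \<exists>i\<in>I. a < b i + \<epsilon>"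
  show "ennreal a \<le> (SUP i\<in>I. ennreal (b i))"
  proof (rule ennreal_le_epsilon)
    fix \<epsilon> :: real assume "0 < \<epsilon>"
    with approx obtain i where i: "i \<in> I" "a < b i + \<epsilon>" by blast
    then have "ennreal a \<le> ennreal (b i) + ennreal \<epsilon>"
      using assms(2) \<open>0 < \<epsilon>\<close> by (simp add: ennreal_leI flip: ennreal_plus)
    also have "\<dots> \<le> (SUP i\<in>I. ennreal (b i)) + ennreal \<epsilon>"
      using i(1) by (intro add_right_mono SUP_upper)
    finally show "ennreal a \<le> (SUP i\<in>I. ennreal (b i)) + ennreal \<epsilon>" .
  qed
qed

lemma outer_regular_iff_approx:
  fixes M :: "'a::t2_space measure"
  assumes "finite_measure M" and sets: "sets M = sets borel" and A: "A \<in> sets borel"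
  shows "emeasure M A = (INF U\<in>{U. open U \<and> A \<subseteq> U}. emeasure M U) \<longleftrightarrow>
    (\<forall>\<epsilon>>0. \<exists>U. open U \<and> A \<subseteq> U \<and> measure M (U - A) < \<epsilon>)"
proof -
  interpret finite_measure M by fact
  have diff: "U \<in> {U. open U \<and> A \<subseteq> U} \<and> measure M U < measure M A + \<epsilon> \<longleftrightarrow>
      open U \<and> A \<subseteq> U \<and> measure M (U - A) < \<epsilon>" for U \<epsilon>
    using finite_measure_Diff[of U A] A sets by auto
  have INF_ge: "emeasure M A \<le> (INF U\<in>{U. open U \<and> A \<subseteq> U}. emeasure M U)"
    using sets by (intro INF_greatest emeasure_mono) auto
  have "emeasure M A = (INF U\<in>{U. open U \<and> A \<subseteq> U}. emeasure M U) \<longleftrightarrow>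
      (INF U\<in>{U. open U \<and> A \<subseteq> U}. ennreal (measure M U)) \<le> ennreal (measure M A)"
    using INF_ge by (simp only: order.eq_iff[of "emeasure M A"] simp_thms flip: emeasure_eq_measure)
  also have "\<dots> \<longleftrightarrow> (\<forall>\<epsilon>>0. \<exists>U\<in>{U. open U \<and> A \<subseteq> U}. measure M U < measure M A + \<epsilon>)"
    by (rule INF_ennreal_le_iff) auto
  also have "\<dots> \<longleftrightarrow> (\<forall>\<epsilon>>0. \<exists>U. open U \<and> A \<subseteq> U \<and> measure M (U - A) < \<epsilon>)"
    by (simp only: Bex_def diff)
  finally show ?thesis .
qed

lemma inner_regular_iff_approx:
  fixes M :: "'a::t2_space measure"
  assumes "finite_measure M" and sets: "sets M = sets borel" and U: "open U"
  shows "emeasure M U = (SUP C\<in>{C. compact C \<and> C \<subseteq> U}. emeasure M C) \<longleftrightarrow>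
    (\<forall>\<epsilon>>0. \<exists>C. compact C \<and> C \<subseteq> U \<and> measure M (U - C) < \<epsilon>)"
proof -
  interpret finite_measure M by fact
  have diff: "C \<in> {C. compact C \<and> C \<subseteq> U} \<and> measure M U < measure M C + \<epsilon> \<longleftrightarrow>
      compact C \<and> C \<subseteq> U \<and> measure M (U - C) < \<epsilon>" for C \<epsilon>
    using finite_measure_Diff[of U C] U sets by (auto simp: borel_compact)
  have "{} \<in> {C. compact C \<and> C \<subseteq> U}" by simp
  then have nonempty: "{C. compact C \<and> C \<subseteq> U} \<noteq> {}" by (metis empty_iff)
  have SUP_le: "(SUP C\<in>{C. compact C \<and> C \<subseteq> U}. emeasure M C) \<le> emeasure M U"
    using U sets by (intro SUP_least emeasure_mono) auto
  have "emeasure M U = (SUP C\<in>{C. compact C \<and> C \<subseteq> U}. emeasure M C) \<longleftrightarrow>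
      ennreal (measure M U) \<le> (SUP C\<in>{C. compact C \<and> C \<subseteq> U}. ennreal (measure M C))"
    using SUP_le by (simp only: order.eq_iff[of "emeasure M U"] simp_thms flip: emeasure_eq_measure)
  also have "\<dots> \<longleftrightarrow> (\<forall>\<epsilon>>0. \<exists>C\<in>{C. compact C \<and> C \<subseteq> U}. measure M U < measure M C + \<epsilon>)"
    by (rule ennreal_le_SUP_iff[OF nonempty]) simp
  also have "\<dots> \<longleftrightarrow> (\<forall>\<epsilon>>0. \<exists>C. compact C \<and> C \<subseteq> U \<and> measure M (U - C) < \<epsilon>)"
    by (simp only: Bex_def diff)
  finally show ?thesis .
qed

lemma radon_measure_iff_approx:
  fixes M :: "'a::t2_space measure"
  assumes fin: "finite_measure M" and sets: "sets M = sets borel"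
  shows "radon_measure M \<longleftrightarrow>
    (\<forall>A\<in>sets borel. \<forall>\<epsilon>>0. \<exists>U. open U \<and> A \<subseteq> U \<and> measure M (U - A) < \<epsilon>) \<and>
    (\<forall>U. open U \<longrightarrow> (\<forall>\<epsilon>>0. \<exists>C. compact C \<and> C \<subseteq> U \<and> measure M (U - C) < \<epsilon>))"
proof -
  have outer: "(\<forall>A\<in>sets borel. emeasure M A = (INF U\<in>{U. open U \<and> A \<subseteq> U}. emeasure M U)) \<longleftrightarrow>
      (\<forall>A\<in>sets borel. \<forall>\<epsilon>>0. \<exists>U. open U \<and> A \<subseteq> U \<and> measure M (U - A) < \<epsilon>)"
    by (intro ball_cong outer_regular_iff_approx fin sets refl)
  have inner: "(\<forall>U. open U \<longrightarrow> emeasure M U = (SUP C\<in>{C. compact C \<and> C \<subseteq> U}. emeasure M C)) \<longleftrightarrow>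
      (\<forall>U. open U \<longrightarrow> (\<forall>\<epsilon>>0. \<exists>C. compact C \<and> C \<subseteq> U \<and> measure M (U - C) < \<epsilon>))"
    by (intro all_cong1 imp_cong inner_regular_iff_approx fin sets refl)
  have "emeasure M C < \<infinity>" for C
    using finite_measure.emeasure_finite[OF fin, of C] by (simp add: less_top)
  with sets show ?thesis unfolding radon_measure_def outer inner by simp
qed

lemma radon_measure_dominated:
  fixes M N :: "'a::t2_space measure"
  assumes rad: "radon_measure M" and fin: "finite_measure M" "finite_measure N"
    and sets: "sets N = sets borel" and "0 \<le> c"
    and dominated: "\<And>A. A \<in> sets borel \<Longrightarrow> measure N A \<le> c * measure M A"
  shows "radon_measure N"
  unfolding radon_measure_iff_approx[OF fin(2) sets]
proof (intro conjI ballI allI impI)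
  have small: "measure N A < \<epsilon>" if "A \<in> sets borel" "measure M A < \<epsilon> / (c + 1)" for A \<epsilon>
  proof -
    have "measure N A \<le> (c + 1) * measure M A"
      using dominated[OF that(1)] mult_right_mono[of c "c + 1" "measure M A"] by simp
    also have "\<dots> < \<epsilon>" using \<open>0 \<le> c\<close> that(2) by (simp add: field_simps)
    finally show ?thesis .
  qed
  note regular = rad[unfolded radon_measure_iff_approx[OF fin(1) sets_radon_measure[OF rad]]]
  fix \<epsilon> :: real assume "0 < \<epsilon>"
  then have pos: "0 < \<epsilon> / (c + 1)" using \<open>0 \<le> c\<close> by simp
  show "\<exists>U. open U \<and> A \<subseteq> U \<and> measure N (U - A) < \<epsilon>" if A: "A \<in> sets borel" for A
  proof -
    obtain U where "open U" "A \<subseteq> U" "measure M (U - A) < \<epsilon> / (c + 1)"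
      using conjunct1[OF regular, rule_format, OF A pos] by blast
    with A show ?thesis by (intro exI[of _ U] conjI small) auto
  qed
  show "\<exists>C. compact C \<and> C \<subseteq> U \<and> measure N (U - C) < \<epsilon>" if U: "open U" for U
  proof -
    obtain C where "compact C" "C \<subseteq> U" "measure M (U - C) < \<epsilon> / (c + 1)"
      using conjunct2[OF regular, rule_format, OF U pos] by blast
    with U show ?thesis by (intro exI[of _ C] conjI small sets.Diff borel_open borel_compact)
  qed
qed

lemma
  fixes M :: "'a::t2_space measure" and g :: "'a \<Rightarrow> ennreal"
  assumes rad: "radon_measure M" and "finite_measure M"
    and g: "g \<in> borel_measurable M" "\<And>x. g x \<le> ennreal c" and "0 \<le> c"
  shows finite_measure_density_bounded: "finite_measure (density M g)"
    and radon_measure_density_bounded: "radon_measure (density M g)"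
proof -
  interpret M: finite_measure M by fact
  note sets = sets_radon_measure[OF rad]
  have dominated: "emeasure (density M g) A \<le> ennreal (c * measure M A)" if "A \<in> sets M" for A
  proof -
    have "emeasure (density M g) A \<le> (\<integral>\<^sup>+x. ennreal c * indicator A x \<partial>M)"
      using g that by (subst emeasure_density) (auto intro!: nn_integral_mono mult_right_mono)
    then show ?thesis
      using that \<open>0 \<le> c\<close>
      by (simp add: nn_integral_cmult_indicator M.emeasure_eq_measure ennreal_mult)
  qed
  show fin: "finite_measure (density M g)"
    using dominated[OF sets.top] by (intro finite_measureI) (auto simp: top_unique)
  interpret N: finite_measure "density M g" by fact
  show "radon_measure (density M g)"
    using dominated sets \<open>0 \<le> c\<close>
    by (intro radon_measure_dominated[OF rad \<open>finite_measure M\<close> fin])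
      (auto simp: N.emeasure_eq_measure)
qed

lemma radon_measure_uniform_measure:
  assumes "radon_measure M" and "finite_measure M" and "V \<in> sets M" and "emeasure M V \<noteq> 0"
  shows "radon_measure (uniform_measure M V)"
proof -
  interpret finite_measure M by fact
  have "indicator V x / emeasure M V \<le> ennreal (1 / measure M V)" for x
    using assms(4) by (auto simp: emeasure_eq_measure divide_ennreal[symmetric]
        zero_less_measure_iff split: split_indicator)
  then show ?thesis
    unfolding uniform_measure_def
    using assms by (intro radon_measure_density_bounded[where c = "1 / measure M V"]) auto
qed

lemma
  assumes "radon_measure M" and "finite_measure M" and "V \<in> sets M"
  shows finite_measure_restriction: "finite_measure (density M (indicator V))"
    and radon_measure_restriction: "radon_measure (density M (indicator V))"
  using finite_measure_density_bounded[of M "indicator V" 1]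
    radon_measure_density_bounded[of M "indicator V" 1] assms
  by (simp_all add: indicator_def)

lemma radon_measure_return: "radon_measure (return borel (x :: 'a::t2_space))"
proof -
  interpret prob_space "return borel x" by (rule prob_space_return) simp
  have outer: "\<exists>U. open U \<and> A \<subseteq> U \<and> measure (return borel x) (U - A) < \<epsilon>"
    if "A \<in> sets borel" "0 < \<epsilon>" for A \<epsilon>
    using that
    by (intro exI[of _ "if x \<in> A then UNIV else - {x}"]) (auto simp: measure_return indicator_def)
  have inner: "\<exists>C. compact C \<and> C \<subseteq> U \<and> measure (return borel x) (U - C) < \<epsilon>"
    if "open U" "0 < \<epsilon>" for U \<epsilon>
    using that
    by (intro exI[of _ "if x \<in> U then {x} else {}"]) (auto simp: measure_return indicator_def)
  show ?thesis
    using outer inner by (subst radon_measure_iff_approx) (auto intro: finite_measure_axioms)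
qed

lemma radon_measure_support_point:
  assumes rad: "radon_measure M" and "emeasure M UNIV \<noteq> 0"
  obtains u where "\<And>V. \<lbrakk>open V; u \<in> V\<rbrakk> \<Longrightarrow> emeasure M V \<noteq> 0"
proof (rule ccontr)
  assume "\<not> thesis"
  then have "\<forall>u. \<exists>V. open V \<and> u \<in> V \<and> emeasure M V = 0" using that by blast
  then obtain V where V: "\<And>u. open (V u) \<and> u \<in> V u \<and> emeasure M (V u) = 0" by metis
  note sets = sets_radon_measure[OF rad]
  have "emeasure M C = 0" if C: "compact C" for C
  proof -
    obtain F where F: "F \<subseteq> C" "finite F" "C \<subseteq> (\<Union>u\<in>F. V u)"
      using compactE_image[OF C, of C V] V by blast
    have "(\<Union>u\<in>F. V u) \<in> null_sets M"
      using F V sets by (intro null_sets.finite_UN) auto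
    then have "emeasure M C \<le> 0"
      using emeasure_mono[OF F(3), of M] by (simp add: null_setsD1 null_setsD2)
    then show ?thesis by simp
  qed
  then have "emeasure M UNIV \<le> 0"
    unfolding emeasure_radon_measure_inner[OF rad open_UNIV] by (intro SUP_least) simp
  with assms(2) show False by simp
qed

section \<open>Functions with compact support\<close>

lemma borel_measurable_Cc: "f \<in> Cc \<Longrightarrow> f \<in> borel_measurable borel"
  by (simp add: Cc_def borel_measurable_continuous_onI)

lemma bounded_range_Cc:
  assumes "f \<in> Cc"
  shows "bounded (range f)"
proof -
  let ?K = "closure {x. f x \<noteq> 0}"
  have "compact (f ` ?K)"
    using assms by (intro compact_continuous_image) (auto simp: Cc_def intro: continuous_on_subset)
  then have "bounded (insert 0 (f ` ?K))"
    by (simp add: compact_imp_bounded)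
  moreover have "range f \<subseteq> insert 0 (f ` ?K)"
    using closure_subset[of "{x. f x \<noteq> 0}"] by auto
  ultimately show ?thesis by (rule bounded_subset)
qed

lemma integrable_Cc:
  fixes f :: "'a::t2_space \<Rightarrow> 'b::{banach,second_countable_topology}"
  assumes rad: "radon_measure M" and f: "f \<in> Cc"
  shows "integrable M f"
proof -
  let ?K = "closure {x. f x \<noteq> 0}"
  have [measurable_cong]: "sets M = sets borel" by (rule sets_radon_measure) fact
  have [measurable]: "f \<in> borel_measurable borel" using f by (rule borel_measurable_Cc)
  obtain b where b: "\<And>x. norm (f x) \<le> b"
    using bounded_range_Cc[OF f] by (auto simp: bounded_iff)
  have "integrable M (\<lambda>x. b * indicator ?K x)"
    using emeasure_radon_measure_compact[OF rad, of ?K] f by (auto simp: Cc_def)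
  then show ?thesis
  proof (rule Bochner_Integration.integrable_bound)
    show "AE x in M. norm (f x) \<le> norm (b * indicator ?K x)"
      using b closure_subset[of "{x. f x \<noteq> 0}"]
      by (auto intro!: AE_I2 order_trans[OF b] simp: indicator_def)
  qed measurable
qed

definition Cc_below :: "'a::topological_space set \<Rightarrow> ('a \<Rightarrow> real) set" where
  "Cc_below U = {f \<in> Cc. \<forall>x. 0 \<le> f x \<and> f x \<le> indicator U x}"

lemma Hausdorff_space_euclidean_t2: "Hausdorff_space (euclidean :: 'a::t2_space topology)"
  unfolding Hausdorff_space_def disjnt_def by (metis hausdorff open_openin)

lemma Urysohn_Cc_below:
  fixes U C :: "'a::t2_space set"
  assumes lc: "locally_compact_space (euclidean :: 'a topology)"
    and "compact C" and "open U" and "C \<subseteq> U"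
  obtains f where "f \<in> Cc_below U" and "\<And>x. indicator C x \<le> f x"
proof -
  obtain V L where VL: "open V" "compact L" "C \<subseteq> V" "V \<subseteq> L"
    using lc \<open>compact C\<close> Hausdorff_space_euclidean_t2
      locally_compact_space_compact_closed_compact[of "euclidean :: 'a topology"]
    by (metis compactin_euclidean_iff open_openin)
  have "completely_regular_space (euclidean :: 'a topology)"
    using lc by (intro locally_compact_regular_imp_completely_regular_space)
      (auto simp: Hausdorff_space_euclidean_t2)
  moreover have "closedin euclidean (- (U \<inter> V))" using VL assms by auto
  ultimately obtain f :: "'a \<Rightarrow> real" where f: "continuous_map euclidean (top_of_set {0..1}) f"
      "f ` (- (U \<inter> V)) \<subseteq> {0}" "f ` C \<subseteq> {1}"
    using Urysohn_completely_regular_compact_closed[of 0 1 "euclidean :: 'a topology" C "- (U \<inter> V)"]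
      assms VL by (auto simp: disjnt_def)
  have "closure {x. f x \<noteq> 0} \<subseteq> L"
    using f(2) VL by (intro closure_minimal) (auto intro: compact_imp_closed)
  then have "compact (closure {x. f x \<noteq> 0})"
    using \<open>compact L\<close> by (metis closed_closure compact_Int_closed inf.absorb2)
  moreover have "continuous_on UNIV f" and "\<And>x. f x \<in> {0..1}"
    using f(1) by (auto simp: continuous_map_in_subtopology)
  ultimately show thesis
    using f(2,3) by (intro that[of f]) (auto simp: Cc_below_def Cc_def indicator_def)
qed

lemma emeasure_open_eq_SUP_Cc_below:
  fixes M :: "'a::t2_space measure"
  assumes lc: "locally_compact_space (euclidean :: 'a topology)"
    and rad: "radon_measure M" and U: "open U"
  shows "emeasure M U = (SUP f\<in>Cc_below U. ennreal (LINT x|M. f x))"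
proof (rule antisym)
  note sets = sets_radon_measure[OF rad]
  have integral: "ennreal (LINT x|M. f x) = (\<integral>\<^sup>+x. ennreal (f x) \<partial>M)" if "f \<in> Cc_below U" for f
    using that integrable_Cc[OF rad, of f]
    by (intro nn_integral_eq_integral[symmetric]) (auto simp: Cc_below_def)
  have "emeasure M C \<le> (SUP f\<in>Cc_below U. ennreal (LINT x|M. f x))"
    if C: "compact C" "C \<subseteq> U" for C
  proof -
    obtain f where f: "f \<in> Cc_below U" "\<And>x. indicator C x \<le> f x"
      using Urysohn_Cc_below[OF lc C(1) U C(2)] by blast
    have "emeasure M C = (\<integral>\<^sup>+x. indicator C x \<partial>M)"
      using C sets by (simp add: borel_compact)
    also have "\<dots> \<le> (\<integral>\<^sup>+x. ennreal (f x) \<partial>M)"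
      using f(2) by (intro nn_integral_mono) (simp add: ennreal_indicator[symmetric] ennreal_leI)
    finally show ?thesis
      using f(1) integral by (auto intro: SUP_upper2)
  qed
  then show "emeasure M U \<le> (SUP f\<in>Cc_below U. ennreal (LINT x|M. f x))"
    unfolding emeasure_radon_measure_inner[OF rad U] by (auto intro: SUP_least)
  have "(\<integral>\<^sup>+x. ennreal (f x) \<partial>M) \<le> (\<integral>\<^sup>+x. indicator U x \<partial>M)" if "f \<in> Cc_below U" for f
    using that by (intro nn_integral_mono)
      (simp add: Cc_below_def ennreal_indicator[symmetric] ennreal_leI)
  then show "(SUP f\<in>Cc_below U. ennreal (LINT x|M. f x)) \<le> emeasure M U"
    using U sets by (intro SUP_least) (simp add: integral)
qed

lemma radon_measure_eqI_Cc:
  fixes M N :: "'a::t2_space measure"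
  assumes lc: "locally_compact_space (euclidean :: 'a topology)"
    and M: "radon_measure M" and N: "radon_measure N"
    and eq: "\<And>f :: 'a \<Rightarrow> real. f \<in> Cc \<Longrightarrow> (LINT x|M. f x) = (LINT x|N. f x)"
  shows "M = N"
proof (rule measure_eqI)
  show "sets M = sets N" using M N by (simp add: sets_radon_measure)
  have opens: "emeasure M U = emeasure N U" if "open U" for U
    unfolding emeasure_open_eq_SUP_Cc_below[OF lc M that]
      emeasure_open_eq_SUP_Cc_below[OF lc N that]
    using eq by (intro SUP_cong) (auto simp: Cc_below_def)
  fix A assume "A \<in> sets M"
  then have A: "A \<in> sets borel" using sets_radon_measure[OF M] by simp
  show "emeasure M A = emeasure N A"
    unfolding emeasure_radon_measure_outer[OF M A] emeasure_radon_measure_outer[OF N A]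
    by (intro INF_cong) (auto simp: opens)
qed

lemma
  fixes f :: "'a::topological_space \<Rightarrow> 'b::topological_space"
  assumes hom: "homeomorphism UNIV UNIV f g"
  shows open_supersets_vimage_homeomorphism:
      "{V. open V \<and> f -` A \<subseteq> V} = vimage f ` {U. open U \<and> A \<subseteq> U}"
    and compact_vimage_homeomorphism: "compact C \<Longrightarrow> compact (f -` C)"
    and compact_subsets_vimage_homeomorphism:
      "{D. compact D \<and> D \<subseteq> f -` B} = vimage f ` {C. compact C \<and> C \<subseteq> B}"
proof -
  have cont: "continuous_on UNIV f" "continuous_on UNIV g"
    and inv: "\<And>x. g (f x) = x" "\<And>y. f (g y) = y"
    using hom by (auto simp: homeomorphism_def)
  show "{V. open V \<and> f -` A \<subseteq> V} = vimage f ` {U. open U \<and> A \<subseteq> U}"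
  proof (intro set_eqI iffI)
    fix V assume "V \<in> {V. open V \<and> f -` A \<subseteq> V}"
    then have "V = f -` (g -` V)" "open (g -` V)" "A \<subseteq> g -` V"
      using cont(2) inv by (auto simp: vimage_def intro: open_vimage[unfolded vimage_def])
    then show "V \<in> vimage f ` {U. open U \<and> A \<subseteq> U}" by blast
  qed (auto intro: open_vimage cont)
  have vimage: "f -` A = g ` A" for A
    by (auto simp: image_iff inv) (metis inv(1))
  have compact_f: "compact (f -` C)" if "compact C" for C
    unfolding vimage using that cont(2)
    by (auto intro: compact_continuous_image continuous_on_subset)
  then show "compact C \<Longrightarrow> compact (f -` C)" .
  show "{D. compact D \<and> D \<subseteq> f -` B} = vimage f ` {C. compact C \<and> C \<subseteq> B}"
  proof (intro set_eqI iffI)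
    fix D assume D: "D \<in> {D. compact D \<and> D \<subseteq> f -` B}"
    have "D = f -` (f ` D)"
      using inv(1) by (metis inj_on_inverseI inj_vimage_image_eq)
    moreover have "compact (f ` D)" "f ` D \<subseteq> B"
      using D cont(1) by (auto intro: compact_continuous_image continuous_on_subset)
    ultimately show "D \<in> vimage f ` {C. compact C \<and> C \<subseteq> B}" by blast
  qed (auto intro: compact_f)
qed

lemma radon_measure_distr_homeomorphism:
  fixes M :: "'a::t2_space measure" and f :: "'a \<Rightarrow> 'b::t2_space"
  assumes rad: "radon_measure M" and hom: "homeomorphism UNIV UNIV f g"
  shows "radon_measure (distr M borel f)"
  unfolding radon_measure_def
proof (intro conjI allI impI ballI)
  note sets = sets_radon_measure[OF rad]
  have cont: "continuous_on UNIV f" using hom by (simp add: homeomorphism_def)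
  then have f: "f \<in> M \<rightarrow>\<^sub>M borel"
    using sets by (simp add: borel_measurable_continuous_onI cong: measurable_cong_sets)
  have distr: "emeasure (distr M borel f) A = emeasure M (f -` A)" if "A \<in> sets borel" for A
    using that f by (simp add: emeasure_distr space_eq_UNIV_of_sets_borel[OF sets])
  show "emeasure (distr M borel f) C < \<infinity>" if "compact C" for C
    using that emeasure_radon_measure_compact[OF rad compact_vimage_homeomorphism[OF hom]]
    by (simp add: distr borel_compact)
  show "emeasure (distr M borel f) A = (INF U\<in>{U. open U \<and> A \<subseteq> U}. emeasure (distr M borel f) U)"
    if "A \<in> sets borel" for A
  proof -
    have "f -` A \<in> sets borel"
      using measurable_sets[OF f that] sets by (simp add: space_eq_UNIV_of_sets_borel[OF sets])
    from emeasure_radon_measure_outer[OF rad this]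
    have "emeasure M (f -` A) = (INF U\<in>{U. open U \<and> A \<subseteq> U}. emeasure M (f -` U))"
      by (simp add: open_supersets_vimage_homeomorphism[OF hom] image_image)
    then show ?thesis using that by (simp add: distr cong: INF_cong_simp)
  qed
  show "emeasure (distr M borel f) U = (SUP C\<in>{C. compact C \<and> C \<subseteq> U}. emeasure (distr M borel f) C)"
    if "open U" for U
  proof -
    have "open (f -` U)" using that cont by (rule open_vimage)
    from emeasure_radon_measure_inner[OF rad this]
    have "emeasure M (f -` U) = (SUP C\<in>{C. compact C \<and> C \<subseteq> U}. emeasure M (f -` C))"
      by (simp add: compact_subsets_vimage_homeomorphism[OF hom] image_image)
    then show ?thesis using that by (simp add: distr borel_compact cong: SUP_cong_simp)
  qed
qed simp

section \<open>Measures as complex set functions\<close>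

definition cmeasure :: "'a measure \<Rightarrow> 'a set \<Rightarrow> complex" where
  "cmeasure M A = complex_of_real (measure M A)"

lemma measure_of_borel_cong:
  fixes M :: "'a::topological_space measure"
  assumes "sets M = sets borel" and "\<And>A. A \<in> sets borel \<Longrightarrow> \<phi> A = emeasure M A"
  shows "measure_of UNIV (sets borel) \<phi> = M"
proof -
  have "measure_of UNIV (sets borel) \<phi> = measure_of (space M) (sets M) (emeasure M)"
    using assms space_eq_UNIV_of_sets_borel[OF assms(1)]
    by (metis measure_of_eq sets.sigma_sets_eq sets.space_closed space_borel)
  then show ?thesis
    by (simp add: measure_of_of_measure)
qed

lemma complex_borel_measure_cmeasure:
  assumes "finite_measure M" and "sets M = sets borel"
  shows "complex_borel_measure (cmeasure M)"
  unfolding complex_borel_measure_def cmeasure_def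
  using finite_measure.finite_measure_UNION[OF assms(1)] assms(2)
  by (auto simp: measure_notin_sets intro!: sums_of_real)

lemma total_variation_cmeasure:
  assumes "finite_measure M" and "sets M = sets borel" and "A \<in> sets borel"
  shows "total_variation (cmeasure M) A = emeasure M A"
proof -
  interpret finite_measure M by fact
  let ?P = "{P. finite P \<and> disjoint P \<and> P \<subseteq> sets borel \<and> \<Union>P = A}"
  have "(\<Sum>B\<in>P. ennreal (cmod (cmeasure M B))) = emeasure M A" if "P \<in> ?P" for P
  proof -
    have "(\<Sum>B\<in>P. ennreal (cmod (cmeasure M B))) = (\<Sum>B\<in>P. emeasure M (id B))"
      by (simp add: cmeasure_def emeasure_eq_measure)
    also have "\<dots> = emeasure M (\<Union>B\<in>P. id B)"
      using that assms(2) by (intro sum_emeasure) (auto simp: disjoint_family_on_def disjoint_def)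
    finally show ?thesis using that by simp
  qed
  moreover have "{A} \<in> ?P" using assms(3) by auto
  ultimately show ?thesis
    unfolding total_variation_def by (metis (no_types, lifting) SUP_eq_const empty_iff)
qed

lemma to_measure_cmeasure:
  assumes "finite_measure M" and "sets M = sets borel"
  shows "to_measure (cmeasure M) = M"
  unfolding to_measure_def
  by (rule measure_of_borel_cong)
    (use assms in \<open>auto simp: cmeasure_def finite_measure.emeasure_eq_measure\<close>)

lemma measure_of_total_variation_cmeasure:
  assumes "finite_measure M" and "sets M = sets borel"
  shows "measure_of UNIV (sets borel) (total_variation (cmeasure M)) = M"
  by (rule measure_of_borel_cong) (use assms total_variation_cmeasure in auto)

lemma cmeasure_in_nonneg_radon_measures:
  assumes "finite_measure M" and "radon_measure M"
  shows "cmeasure M \<in> nonneg_radon_measures"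
proof -
  have "sets M = sets borel" by (rule sets_radon_measure) fact
  then show ?thesis
    using complex_borel_measure_cmeasure[OF assms(1)]
      measure_of_total_variation_cmeasure[OF assms(1)] assms(2)
    by (auto simp: nonneg_radon_measures_def complex_radon_measures_def)
      (simp add: cmeasure_def)
qed

lemma nonneg_radon_imp_radon: "\<mu> \<in> nonneg_radon_measures \<Longrightarrow> \<mu> \<in> complex_radon_measures"
  by (simp add: nonneg_radon_measures_def)

lemma sets_to_measure [simp, measurable_cong]: "sets (to_measure \<mu>) = sets borel"
  unfolding to_measure_def
  by (metis sets_measure_of sets.sigma_sets_eq sets.space_closed space_borel)

lemma space_to_measure [simp]: "space (to_measure \<mu>) = UNIV"
  by (rule space_eq_UNIV_of_sets_borel) simp

lemma emeasure_to_measure_complex_borel: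
  fixes \<mu> :: "'a::topological_space set \<Rightarrow> complex"
  assumes complex_borel: "complex_borel_measure \<mu>" and nonneg: "\<And>A. \<mu> A \<in> \<real>\<^sub>\<ge>\<^sub>0"
    and "A \<in> sets borel"
  shows "emeasure (to_measure \<mu>) A = ennreal (Re (\<mu> A))"
  unfolding to_measure_def
proof (rule emeasure_measure_of_sigma)
  have sums: "(\<lambda>i. \<mu> (A i)) sums \<mu> (\<Union>i. A i)"
    if "range A \<subseteq> sets borel" "disjoint_family A" for A :: "nat \<Rightarrow> 'a set"
    using complex_borel that by (auto simp: complex_borel_measure_def)
  have "(\<lambda>i::nat. \<mu> {}) sums \<mu> {}"
    using sums[of "\<lambda>_. {}"] by (simp add: disjoint_family_on_def)
  then have "\<mu> {} = 0" by (metis sums_iff summable_const_iff)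
  then show "positive (sets borel) (\<lambda>A. ennreal (Re (\<mu> A)))" by (simp add: positive_def)
  show "countably_additive (sets borel) (\<lambda>A. ennreal (Re (\<mu> A)))"
  proof (rule countably_additiveI)
    fix A :: "nat \<Rightarrow> 'a set"
    assume A: "range A \<subseteq> sets borel" "disjoint_family A"
    have "(\<lambda>i. Re (\<mu> (A i))) sums Re (\<mu> (\<Union>i. A i))"
      using sums[OF A] by (rule sums_Re)
    then show "(\<Sum>i. ennreal (Re (\<mu> (A i)))) = ennreal (Re (\<mu> (\<Union>i. A i)))"
      using nonneg by (simp add: complex_nonneg_Reals_iff suminf_ennreal2 sums_iff)
  qed
  show "sigma_algebra UNIV (sets (borel :: 'a measure))"
    by (metis sets.sigma_algebra_axioms space_borel)
qed fact

lemma nonneg_radon_measure_cases: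
  assumes "\<mu> \<in> nonneg_radon_measures"
  obtains M where "finite_measure M" and "radon_measure M" and "\<mu> = cmeasure M"
proof -
  have complex_borel: "complex_borel_measure \<mu>" and nonneg: "\<And>A. \<mu> A \<in> \<real>\<^sub>\<ge>\<^sub>0"
    using assms by (auto simp: nonneg_radon_measures_def complex_radon_measures_def)
  note emeasure_eq = emeasure_to_measure_complex_borel[OF complex_borel nonneg]
  have fin: "finite_measure (to_measure \<mu>)"
    by (rule finite_measureI) (simp add: emeasure_eq)
  have "measure (to_measure \<mu>) A = Re (\<mu> A)" for A
    using emeasure_eq[of A] nonneg[of A] complex_borel
    by (cases "A \<in> sets borel")
      (auto simp: measure_def emeasure_notin_sets complex_borel_measure_def
        complex_nonneg_Reals_iff)
  then have \<mu>: "\<mu> = cmeasure (to_measure \<mu>)"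
    using nonneg by (auto simp: cmeasure_def complex_nonneg_Reals_iff complex_eq_iff)
  moreover have "radon_measure (to_measure \<mu>)"
    using assms measure_of_total_variation_cmeasure[OF fin]
    by (simp add: \<mu>[symmetric] nonneg_radon_measures_def complex_radon_measures_def)
  ultimately show thesis using fin that by blast
qed

lemma
  assumes "\<mu> \<in> nonneg_radon_measures"
  shows finite_measure_to_measure: "finite_measure (to_measure \<mu>)"
    and radon_measure_to_measure: "radon_measure (to_measure \<mu>)"
    and cmeasure_to_measure: "cmeasure (to_measure \<mu>) = \<mu>"
    and emeasure_to_measure: "emeasure (to_measure \<mu>) A = ennreal (Re (\<mu> A))"
    and total_variation_nonneg:
      "B \<in> sets borel \<Longrightarrow> total_variation \<mu> B = emeasure (to_measure \<mu>) B"
proof -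
  obtain M where M: "finite_measure M" "radon_measure M" "\<mu> = cmeasure M"
    by (rule nonneg_radon_measure_cases[OF assms])
  note sets = sets_radon_measure[OF M(2)]
  have \<mu>: "to_measure \<mu> = M"
    using M sets by (simp add: to_measure_cmeasure)
  show "finite_measure (to_measure \<mu>)" "radon_measure (to_measure \<mu>)"
    "cmeasure (to_measure \<mu>) = \<mu>"
    unfolding \<mu> by (simp_all add: M)
  show "emeasure (to_measure \<mu>) A = ennreal (Re (\<mu> A))"
    unfolding \<mu> by (simp add: M cmeasure_def finite_measure.emeasure_eq_measure)
  show "B \<in> sets borel \<Longrightarrow> total_variation \<mu> B = emeasure (to_measure \<mu>) B"
    unfolding \<mu> using M sets by (simp add: total_variation_cmeasure)
qed

lemma cmeasure_restriction_add:
  assumes fin: "finite_measure M" and V: "V \<in> sets M"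
  shows "cmeasure M =
    (\<lambda>A. cmeasure (density M (indicator V)) A + cmeasure (density M (indicator (space M - V))) A)"
proof
  interpret finite_measure M by fact
  have restriction: "measure (density M (indicator W)) A = measure M (W \<inter> A)"
    if "A \<in> sets M" "W \<in> sets M" for A W
    using that by (simp add: measure_def emeasure_density indicator_inter_arith[symmetric])
  fix A
  show "cmeasure M A =
      cmeasure (density M (indicator V)) A + cmeasure (density M (indicator (space M - V))) A"
  proof (cases "A \<in> sets M")
    case True
    have "measure M ((V \<inter> A) \<union> ((space M - V) \<inter> A)) =
        measure M (V \<inter> A) + measure M ((space M - V) \<inter> A)"
      using True V by (intro finite_measure_Union) auto
    moreover have "(V \<inter> A) \<union> ((space M - V) \<inter> A) = A"
      using sets.sets_into_space[OF True] by blast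
    ultimately show ?thesis
      using True V by (simp add: cmeasure_def restriction)
  qed (simp add: cmeasure_def measure_notin_sets)
qed

lemma cmeasure_uniform_measure:
  assumes fin: "finite_measure M" and V: "V \<in> sets M" "emeasure M V \<noteq> 0"
  shows "cmeasure (uniform_measure M V) =
    (\<lambda>A. complex_of_real (1 / measure M V) * cmeasure (density M (indicator V)) A)"
proof
  interpret finite_measure M by fact
  fix A
  show "cmeasure (uniform_measure M V) A =
      complex_of_real (1 / measure M V) * cmeasure (density M (indicator V)) A"
  proof (cases "A \<in> sets M")
    case True
    then show ?thesis
      using V by (simp add: cmeasure_def measure_def[of "density M _"] emeasure_density
          indicator_inter_arith[symmetric] emeasure_eq_measure)
  qed (simp add: cmeasure_def measure_notin_sets)
qed

subsection \<open>Point masses\<close>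

lemma cmeasure_return: "cmeasure (return borel x) = point_mass x"
proof
  show "cmeasure (return borel x) A = point_mass x A" for A
    by (cases "A \<in> sets borel")
      (auto simp: cmeasure_def point_mass_def measure_return measure_notin_sets indicator_def)
qed

lemma finite_measure_return_borel: "finite_measure (return borel x)"
  by (simp add: prob_space.finite_measure prob_space_return)

lemma to_measure_point_mass: "to_measure (point_mass x) = return borel x"
  using to_measure_cmeasure[OF finite_measure_return_borel] by (simp add: cmeasure_return)

lemma point_mass_nonneg_radon: "point_mass (x :: 'a::t2_space) \<in> nonneg_radon_measures"
  using cmeasure_in_nonneg_radon_measures[OF finite_measure_return_borel radon_measure_return]
  by (simp add: cmeasure_return)

lemma supp_point_mass: "supp (point_mass x) = {x :: 'a::t2_space}"
proof (intro set_eqI iffI)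
  have total_variation_eq: "total_variation (point_mass x) U = indicator U x" if "open U" for U
    using that
    by (simp add: total_variation_nonneg[OF point_mass_nonneg_radon] to_measure_point_mass)
  show "y \<in> {x}" if "y \<in> supp (point_mass x)" for y
    using that total_variation_eq[of "- {x}"] by (auto simp: supp_def open_Compl)
  show "y \<in> supp (point_mass x)" if "y \<in> {x}" for y
    using that by (simp add: supp_def total_variation_eq)
qed

lemma point_mass_inject: "point_mass x = point_mass y \<longleftrightarrow> x = (y :: 'a::t2_space)"
  using supp_point_mass by (metis singleton_inject)

lemma point_mass_eqI:
  fixes x :: "'a::t2_space"
  assumes \<mu>: "\<mu> \<in> nonneg_radon_measures" and "\<mu> UNIV = 1" and "\<mu> (- {x}) = 0"
  shows "\<mu> = point_mass x"
proof -
  let ?M = "to_measure \<mu>"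
  note emeasure_eq = emeasure_to_measure[OF \<mu>]
  have concentrated: "AE y in ?M. y = x"
    using assms(3) by (intro AE_I[of _ _ "- {x}"]) (auto simp: emeasure_eq)
  have "?M = return borel x"
  proof (rule measure_eqI)
    fix A assume "A \<in> sets ?M"
    then have "emeasure ?M A = emeasure ?M {y \<in> space ?M. x \<in> A}"
      using concentrated by (intro emeasure_eq_AE) (auto elim: eventually_mono)
    also have "\<dots> = indicator A x"
      using assms(2) by (cases "x \<in> A") (simp_all add: emeasure_eq[of UNIV])
    finally show "emeasure ?M A = emeasure (return borel x) A"
      using \<open>A \<in> sets ?M\<close> by simp
  qed simp
  then show ?thesis
    using cmeasure_to_measure[OF \<mu>] by (simp add: cmeasure_return)
qed

lemma point_mass_eqI_Cc:
  fixes x :: "'a::t2_space"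
  assumes lc: "locally_compact_space (euclidean :: 'a topology)"
    and \<mu>: "\<mu> \<in> nonneg_radon_measures" and "\<mu> UNIV = 1"
    and null: "\<And>f. f \<in> Cc_below (- {x}) \<Longrightarrow> (LINT v|to_measure \<mu>. f v) = 0"
  shows "\<mu> = point_mass x"
proof (rule point_mass_eqI[OF \<mu> \<open>\<mu> UNIV = 1\<close>])
  have "emeasure (to_measure \<mu>) (- {x}) =
      (SUP f\<in>Cc_below (- {x}). ennreal (LINT v|to_measure \<mu>. f v))"
    by (intro emeasure_open_eq_SUP_Cc_below lc radon_measure_to_measure \<mu>) auto
  also have "\<dots> \<le> 0" by (rule SUP_least) (simp add: null)
  finally have "Re (\<mu> (- {x})) \<le> 0"
    by (simp add: emeasure_to_measure[OF \<mu>] ennreal_eq_0_iff)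
  moreover have "\<mu> (- {x}) \<in> \<real>\<^sub>\<ge>\<^sub>0" using \<mu> by (simp add: nonneg_radon_measures_def)
  ultimately show "\<mu> (- {x}) = 0" by (simp add: complex_nonneg_Reals_iff complex_eq_iff)
qed

lemma integral_Cc_below_null:
  assumes \<mu>: "\<mu> \<in> nonneg_radon_measures" and "\<mu> U = 0" and U: "U \<in> sets borel"
    and f: "f \<in> Cc_below U"
  shows "(LINT v|to_measure \<mu>. f v) = 0"
proof (rule integral_eq_zero_AE)
  have "f v = 0" if "v \<notin> U" for v
  proof -
    have "0 \<le> f v \<and> f v \<le> indicator U v" using f unfolding Cc_below_def by blast
    with that show ?thesis by simp
  qed
  then show "AE v in to_measure \<mu>. f v = 0"
    using \<open>\<mu> U = 0\<close> U by (intro AE_I[of _ _ U]) (auto simp: emeasure_to_measure[OF \<mu>])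
qed

lemma supp_nonempty:
  assumes \<mu>: "\<mu> \<in> nonneg_radon_measures" and "\<mu> UNIV \<noteq> 0"
  shows "supp \<mu> \<noteq> {}"
proof -
  have "\<mu> UNIV \<in> \<real>\<^sub>\<ge>\<^sub>0" using \<mu> by (simp add: nonneg_radon_measures_def)
  then have "emeasure (to_measure \<mu>) UNIV \<noteq> 0"
    using assms(2)
    by (auto simp: emeasure_to_measure[OF \<mu>] complex_nonneg_Reals_iff complex_eq_iff)
  then obtain u where "\<And>V. \<lbrakk>open V; u \<in> V\<rbrakk> \<Longrightarrow> emeasure (to_measure \<mu>) V \<noteq> 0"
    using radon_measure_support_point[OF radon_measure_to_measure[OF \<mu>]] by metis
  then have "u \<in> supp \<mu>"
    by (simp add: supp_def total_variation_nonneg[OF \<mu>])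
  then show ?thesis by blast
qed

subsection \<open>The cone topology\<close>

lemma limitin_topology_generated_by:
  "limitin (topology_generated_by \<B>) f l F \<longleftrightarrow>
    l \<in> \<Union>\<B> \<and> (\<forall>U\<in>\<B>. l \<in> U \<longrightarrow> (\<forall>\<^sub>F x in F. f x \<in> U))"
proof (intro iffI conjI)
  assume basis: "l \<in> \<Union>\<B> \<and> (\<forall>U\<in>\<B>. l \<in> U \<longrightarrow> (\<forall>\<^sub>F x in F. f x \<in> U))"
  have "\<forall>\<^sub>F x in F. f x \<in> U" if "generate_topology_on \<B> U" "l \<in> U" for U
    using that
  proof induction
    case (UN K)
    then obtain A where A: "A \<in> K" "l \<in> A" by blast
    from UN.IH[OF this] show ?case by (rule eventually_mono) (use A in blast)
  qed (use basis in \<open>simp_all add: eventually_conj_iff\<close>)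
  with basis show "limitin (topology_generated_by \<B>) f l F"
    by (simp add: limitin_def openin_topology_generated_by_iff)
qed (auto simp: limitin_def topology_generated_by_Basis)

definition cone_test_functions :: "('a::topological_space \<Rightarrow> real) set" where
  "cone_test_functions = {f. f \<in> Cc \<and> (\<forall>x. 0 \<le> f x) \<or> f = (\<lambda>x. 1)}"

lemma cone_topology_eq:
  "cone_topology = topology_generated_by
    {{\<mu> \<in> nonneg_radon_measures. (LINT x|to_measure \<mu>. f x) \<in> V} | f V.
      open V \<and> f \<in> cone_test_functions}"
  by (simp add: cone_topology_def cone_test_functions_def)

lemma openin_cone_topology_integral:
  assumes "f \<in> cone_test_functions" and "open V"
  shows "openin cone_topology {\<mu> \<in> nonneg_radon_measures. (LINT x|to_measure \<mu>. f x) \<in> V}"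
  unfolding cone_topology_eq
  by (intro topology_generated_by_Basis CollectI exI[of _ f] exI[of _ V] conjI refl assms)

lemma topspace_cone_topology: "topspace cone_topology = nonneg_radon_measures"
proof
  show "nonneg_radon_measures \<subseteq> topspace cone_topology"
    using openin_subset[OF openin_cone_topology_integral[of "\<lambda>x. 1" UNIV]]
    by (simp add: cone_test_functions_def)
  show "topspace cone_topology \<subseteq> nonneg_radon_measures"
    unfolding cone_topology_eq topology_generated_by_topspace by (rule Union_least) auto
qed

lemma limitin_cone_topology_iff:
  fixes \<mu> :: "'i \<Rightarrow> 'a::t2_space set \<Rightarrow> complex"
  shows "limitin cone_topology \<mu> l F \<longleftrightarrow>
    l \<in> nonneg_radon_measures \<and> (\<forall>\<^sub>F i in F. \<mu> i \<in> nonneg_radon_measures) \<and>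
    (\<forall>f\<in>cone_test_functions. ((\<lambda>i. LINT x|to_measure (\<mu> i). f x) \<longlongrightarrow> (LINT x|to_measure l. f x)) F)"
proof (intro iffI conjI ballI)
  assume lim: "limitin cone_topology \<mu> l F"
  then show "l \<in> nonneg_radon_measures" and "\<forall>\<^sub>F i in F. \<mu> i \<in> nonneg_radon_measures"
    using limitin_topspace[OF lim] limitinD[OF lim openin_topspace]
    by (simp_all add: topspace_cone_topology)
  fix f :: "'a \<Rightarrow> real" assume f: "f \<in> cone_test_functions"
  show "((\<lambda>i. LINT x|to_measure (\<mu> i). f x) \<longlongrightarrow> (LINT x|to_measure l. f x)) F"
  proof (rule topological_tendstoI)
    fix V :: "real set" assume V: "open V" "(LINT x|to_measure l. f x) \<in> V"
    from limitinD[OF lim openin_cone_topology_integral[OF f V(1)]]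
    show "\<forall>\<^sub>F i in F. (LINT x|to_measure (\<mu> i). f x) \<in> V"
      using V \<open>l \<in> nonneg_radon_measures\<close> by (auto elim: eventually_mono)
  qed
next
  assume lim: "l \<in> nonneg_radon_measures \<and> (\<forall>\<^sub>F i in F. \<mu> i \<in> nonneg_radon_measures) \<and>
    (\<forall>f\<in>cone_test_functions. ((\<lambda>i. LINT x|to_measure (\<mu> i). f x) \<longlongrightarrow> (LINT x|to_measure l. f x)) F)"
  then have "l \<in> topspace cone_topology" by (simp add: topspace_cone_topology)
  moreover have "\<forall>\<^sub>F i in F. \<mu> i \<in> {\<mu> \<in> nonneg_radon_measures. (LINT x|to_measure \<mu>. f x) \<in> V}"
    if "open V" "f \<in> cone_test_functions" "(LINT x|to_measure l. f x) \<in> V" for f V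
    using lim that(2) topological_tendstoD[of _ _ F, OF _ that(1,3)]
    by (simp add: eventually_conj_iff)
  ultimately show "limitin cone_topology \<mu> l F"
    unfolding cone_topology_eq limitin_topology_generated_by topology_generated_by_topspace
    by blast
qed

lemma integral_uniform_measure_approx:
  fixes f :: "'a \<Rightarrow> real"
  assumes V: "emeasure M V \<noteq> 0" "emeasure M V \<noteq> \<infinity>"
    and f: "f \<in> borel_measurable M" "\<And>x. x \<in> V \<Longrightarrow> \<bar>f x - c\<bar> \<le> \<epsilon>"
  shows "\<bar>(LINT x|uniform_measure M V. f x) - c\<bar> \<le> \<epsilon>"
proof -
  interpret prob_space "uniform_measure M V" using V by (rule prob_space_uniform_measure)
  have close: "AE x in uniform_measure M V. \<bar>f x - c\<bar> \<le> \<epsilon>"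
    using V f(2) by (intro AE_uniform_measureI AE_I2) (auto simp: emeasure_neq_0_sets)
  then have "AE x in uniform_measure M V. norm (f x) \<le> \<bar>c\<bar> + \<epsilon>"
    by (rule eventually_mono) auto
  then have f_integrable: "integrable (uniform_measure M V) f"
    using f(1) by (intro integrable_const_bound) auto
  have "\<bar>(LINT x|uniform_measure M V. f x) - c\<bar> = \<bar>LINT x|uniform_measure M V. f x - c\<bar>"
    using f_integrable prob_space by simp
  also have "\<dots> \<le> (LINT x|uniform_measure M V. \<bar>f x - c\<bar>)"
    by (rule integral_abs_bound)
  also have "\<dots> \<le> \<epsilon>"
    using f_integrable close by (intro integral_le_const) auto
  finally show ?thesis .
qed

lemma limitin_uniform_measure_point_mass:
  fixes M :: "'a::t2_space measure"
  assumes rad: "radon_measure M" and fin: "finite_measure M"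
    and pos: "\<forall>\<^sub>F i in F. V i \<in> sets M \<and> emeasure M (V i) \<noteq> 0"
    and shrink: "\<And>U. \<lbrakk>open U; u \<in> U\<rbrakk> \<Longrightarrow> \<forall>\<^sub>F i in F. V i \<subseteq> U"
  shows "limitin cone_topology (\<lambda>i. cmeasure (uniform_measure M (V i))) (point_mass u) F"
  unfolding limitin_cone_topology_iff
proof (intro conjI ballI)
  interpret finite_measure M by fact
  note sets [measurable_cong] = sets_radon_measure[OF rad]
  have uniform: "finite_measure (uniform_measure M N)" "radon_measure (uniform_measure M N)"
    if "N \<in> sets M" "emeasure M N \<noteq> 0" for N
    using that radon_measure_uniform_measure[OF rad fin]
    by (auto intro!: prob_space.finite_measure prob_space_uniform_measure)
  show "point_mass u \<in> nonneg_radon_measures" by (rule point_mass_nonneg_radon)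
  show "\<forall>\<^sub>F i in F. cmeasure (uniform_measure M (V i)) \<in> nonneg_radon_measures"
    using pos by (rule eventually_mono) (simp add: cmeasure_in_nonneg_radon_measures uniform)
  let ?\<mu> = "\<lambda>i. cmeasure (uniform_measure M (V i))"
  fix f :: "'a \<Rightarrow> real" assume "f \<in> cone_test_functions"
  then have cont: "continuous_on UNIV f" by (auto simp: cone_test_functions_def Cc_def)
  then have [measurable]: "f \<in> borel_measurable borel" by (rule borel_measurable_continuous_onI)
  have "((\<lambda>i. LINT x|to_measure (?\<mu> i). f x) \<longlongrightarrow> f u) F"
  proof (rule tendstoI)
    fix \<epsilon> :: real assume "0 < \<epsilon>"
    have "open (f -` ball (f u) (\<epsilon> / 2))" using cont by (intro open_vimage) auto
    then have "\<forall>\<^sub>F i in F. V i \<subseteq> f -` ball (f u) (\<epsilon> / 2)" by (rule shrink) (simp add: \<open>0 < \<epsilon>\<close>)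
    with pos show "\<forall>\<^sub>F i in F. dist (LINT x|to_measure (?\<mu> i). f x) (f u) < \<epsilon>"
    proof eventually_elim
      case (elim i)
      then have "\<bar>(LINT x|uniform_measure M (V i). f x) - f u\<bar> \<le> \<epsilon> / 2"
        by (intro integral_uniform_measure_approx)
          (auto simp: dist_real_def less_imp_le subset_iff abs_minus_commute)
      with elim \<open>0 < \<epsilon>\<close> show ?case
        by (simp add: to_measure_cmeasure uniform sets dist_real_def)
    qed
  qed
  then show "((\<lambda>i. LINT x|to_measure (?\<mu> i). f x) \<longlongrightarrow>
      (LINT x|to_measure (point_mass u). f x)) F"
    by (simp add: to_measure_point_mass integral_return)
qed

lemma neighbourhood_filter:
  fixes u :: "'a::topological_space"
  obtains F :: "'a set filter" where "F \<noteq> bot" and "\<forall>\<^sub>F V in F. open V \<and> u \<in> V"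
    and "\<And>U. \<lbrakk>open U; u \<in> U\<rbrakk> \<Longrightarrow> \<forall>\<^sub>F V in F. V \<subseteq> U"
proof
  let ?F = "INF U\<in>{U. open U \<and> u \<in> U}. principal {V. open V \<and> u \<in> V \<and> V \<subseteq> U}"
  have eventually_iff: "eventually P ?F \<longleftrightarrow>
      (\<exists>U. open U \<and> u \<in> U \<and> (\<forall>V. open V \<and> u \<in> V \<and> V \<subseteq> U \<longrightarrow> P V))" for P
  proof (subst eventually_INF_base)
    show "{U. open U \<and> u \<in> U} \<noteq> {}" using open_UNIV by blast
    fix A B assume "A \<in> {U. open U \<and> u \<in> U}" "B \<in> {U. open U \<and> u \<in> U}"
    then show "\<exists>C\<in>{U. open U \<and> u \<in> U}. principal {V. open V \<and> u \<in> V \<and> V \<subseteq> C} \<le>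
        inf (principal {V. open V \<and> u \<in> V \<and> V \<subseteq> A}) (principal {V. open V \<and> u \<in> V \<and> V \<subseteq> B})"
      by (intro bexI[of _ "A \<inter> B"]) auto
  qed (auto simp: eventually_principal)
  show "?F \<noteq> bot" unfolding trivial_limit_def eventually_iff by blast
  show "\<forall>\<^sub>F V in ?F. open V \<and> u \<in> V" unfolding eventually_iff using open_UNIV by blast
  show "\<forall>\<^sub>F V in ?F. V \<subseteq> U" if "open U" "u \<in> U" for U
    unfolding eventually_iff using that by blast
qed

section \<open>Translation by central elements\<close>

context hypergroup
begin

lemma conv_point_mass_assoc:
  "conv (conv (point_mass x) (point_mass y)) (point_mass z) =
    conv (point_mass x) (conv (point_mass y) (point_mass z))"
  by (intro conv_assoc nonneg_radon_imp_radon point_mass_nonneg_radon)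

lemma conv_add_null:
  assumes \<mu>: "\<mu> \<in> nonneg_radon_measures" and \<nu>: "\<nu> \<in> nonneg_radon_measures"
    and \<sigma>: "\<sigma> \<in> nonneg_radon_measures" and null: "conv (\<lambda>A. \<mu> A + \<nu> A) \<sigma> B = 0"
  shows "conv \<mu> \<sigma> B = 0"
proof -
  have "conv \<mu> \<sigma> B + conv \<nu> \<sigma> B = 0"
    using null conv_add_left[of \<mu> \<nu> \<sigma>] \<mu> \<nu> \<sigma> by (simp add: nonneg_radon_imp_radon)
  moreover have "conv \<mu> \<sigma> B \<in> \<real>\<^sub>\<ge>\<^sub>0" "conv \<nu> \<sigma> B \<in> \<real>\<^sub>\<ge>\<^sub>0"
    using conv_nonneg[OF \<mu> \<sigma>] conv_nonneg[OF \<nu> \<sigma>] by (auto simp: nonneg_radon_measures_def)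
  ultimately show ?thesis
    by (auto simp: complex_nonneg_Reals_iff complex_eq_iff add_nonneg_eq_0_iff)
qed

lemma conv_uniform_measure_null:
  assumes rad: "radon_measure M" and fin: "finite_measure M"
    and V: "V \<in> sets M" "emeasure M V \<noteq> 0"
    and \<sigma>: "\<sigma> \<in> nonneg_radon_measures" and null: "conv (cmeasure M) \<sigma> B = 0"
  shows "conv (cmeasure (uniform_measure M V)) \<sigma> B = 0"
proof -
  have restriction: "cmeasure (density M (indicator W)) \<in> nonneg_radon_measures"
    if "W \<in> sets M" for W
    by (intro cmeasure_in_nonneg_radon_measures finite_measure_restriction
        radon_measure_restriction rad fin that)
  have "conv (cmeasure (density M (indicator V))) \<sigma> B = 0"
    using null V(1) unfolding cmeasure_restriction_add[OF fin V(1)]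
    by (intro conv_add_null[OF restriction restriction \<sigma>]) auto
  then show ?thesis
    unfolding cmeasure_uniform_measure[OF fin V]
    by (subst conv_scale_left) (use restriction V \<sigma> in \<open>auto intro: nonneg_radon_imp_radon\<close>)
qed

lemma continuous_map_conv_left:
  assumes "\<sigma> \<in> nonneg_radon_measures"
  shows "continuous_map cone_topology cone_topology (\<lambda>\<mu>. conv \<mu> \<sigma>)"
proof -
  have "continuous_map cone_topology (prod_topology cone_topology cone_topology) (\<lambda>\<mu>. (\<mu>, \<sigma>))"
    using assms by (intro continuous_map_pairedI) (simp_all add: topspace_cone_topology)
  from continuous_map_compose[OF this conv_continuous] show ?thesis
    by (simp add: o_def)
qed

text \<open>The normalized restrictions of \<open>\<mu>\<close> to small neighbourhoods of \<open>u\<close> tend to \<open>\<delta>\<^sub>u\<close>, and their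
  products with \<open>\<delta>\<^sub>y\<close> vanish wherever \<open>\<mu> * \<delta>\<^sub>y = \<delta>\<^sub>x\<close> does.\<close>

lemma conv_support_point:
  assumes \<mu>: "\<mu> \<in> nonneg_radon_measures" and u: "u \<in> supp \<mu>"
    and conv: "conv \<mu> (point_mass y) = point_mass x"
  shows "conv (point_mass u) (point_mass y) = point_mass x"
proof -
  let ?M = "to_measure \<mu>" and ?\<tau> = "conv (point_mass u) (point_mass y)"
  let ?\<rho> = "\<lambda>V. conv (cmeasure (uniform_measure ?M V)) (point_mass y)"
  note rad = radon_measure_to_measure[OF \<mu>] and fin = finite_measure_to_measure[OF \<mu>]
  obtain F where F: "F \<noteq> bot" "\<forall>\<^sub>F V in F. open V \<and> u \<in> V"
    and shrink: "\<And>U. \<lbrakk>open U; u \<in> U\<rbrakk> \<Longrightarrow> \<forall>\<^sub>F V in F. V \<subseteq> U"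
    using neighbourhood_filter[where u = u] by metis
  have pos: "\<forall>\<^sub>F V in F. V \<in> sets ?M \<and> emeasure ?M V \<noteq> 0"
    using F(2) by (rule eventually_mono)
      (use u in \<open>auto simp: supp_def total_variation_nonneg[OF \<mu>]\<close>)
  have "limitin cone_topology (\<lambda>V. cmeasure (uniform_measure ?M V)) (point_mass u) F"
    by (rule limitin_uniform_measure_point_mass[OF rad fin pos shrink])
  from continuous_map_limit[OF continuous_map_conv_left[OF point_mass_nonneg_radon] this]
  have lim: "limitin cone_topology ?\<rho> ?\<tau> F" by (simp add: o_def)
  have null: "\<forall>\<^sub>F V in F. ?\<rho> V (- {x}) = 0"
    using pos
  proof (rule eventually_mono)
    fix V assume "V \<in> sets ?M \<and> emeasure ?M V \<noteq> 0"
    then show "?\<rho> V (- {x}) = 0"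
      by (intro conv_uniform_measure_null[OF rad fin _ _ point_mass_nonneg_radon])
        (simp_all add: cmeasure_to_measure[OF \<mu>] conv point_mass_def)
  qed
  show ?thesis
  proof (rule point_mass_eqI_Cc[OF locally_compact point_conv_prob])
    fix f assume f: "f \<in> Cc_below (- {x})"
    then have "f \<in> cone_test_functions"
      by (simp add: Cc_below_def cone_test_functions_def)
    with lim have "((\<lambda>V. LINT v|to_measure (?\<rho> V). f v) \<longlongrightarrow> (LINT v|to_measure ?\<tau>. f v)) F"
      and nonneg: "\<forall>\<^sub>F V in F. ?\<rho> V \<in> nonneg_radon_measures"
      by (simp_all add: limitin_cone_topology_iff)
    moreover have "\<forall>\<^sub>F V in F. (LINT v|to_measure (?\<rho> V). f v) = 0"
      using null nonneg by eventually_elim (rule integral_Cc_below_null[OF _ _ _ f], auto)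
    ultimately show "(LINT v|to_measure ?\<tau>. f v) = 0"
      using tendsto_unique[OF F(1) _ tendsto_eventually] by blast
  qed
qed

abbreviation Z :: "'a set" where
  "Z \<equiv> hg_center conv invol e"

abbreviation translation :: "'a \<Rightarrow> 'a \<Rightarrow> 'a" where
  "translation z x \<equiv> hg_mult conv x z"

lemma invol_center: "z \<in> Z \<Longrightarrow> invol z \<in> Z"
  by (simp add: hg_center_def invol_invol)

lemma
  assumes z: "z \<in> Z"
  shows conv_center: "conv (point_mass x) (point_mass z) = point_mass (translation z x)"
    and supp_conv_center: "supp (conv (point_mass x) (point_mass z)) = {translation z x}"
proof -
  let ?\<mu> = "conv (point_mass x) (point_mass z)"
  obtain u where u: "u \<in> supp ?\<mu>"
    using supp_nonempty[OF point_conv_prob(1)[of x z]] by (auto simp: point_conv_prob(2))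
  have "conv ?\<mu> (point_mass (invol z)) = point_mass x"
    using z by (simp add: conv_point_mass_assoc hg_center_def unit)
  then have "conv (point_mass u) (point_mass (invol z)) = point_mass x"
    by (rule conv_support_point[OF point_conv_prob(1) u])
  then have "?\<mu> = conv (conv (point_mass u) (point_mass (invol z))) (point_mass z)"
    by simp
  also have "\<dots> = point_mass u"
    using z by (simp add: conv_point_mass_assoc hg_center_def unit)
  finally show "?\<mu> = point_mass (translation z x)" and "supp ?\<mu> = {translation z x}"
    by (simp_all add: hg_mult_def supp_point_mass)
qed

lemma translation_invol:
  assumes z: "z \<in> Z"
  shows "translation (invol z) (translation z x) = x"
proof -
  have "point_mass (translation (invol z) (translation z x)) =
      conv (conv (point_mass x) (point_mass z)) (point_mass (invol z))"
    by (simp add: conv_center z invol_center)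
  also have "\<dots> = point_mass x"
    using z by (simp add: conv_point_mass_assoc hg_center_def unit)
  finally show ?thesis by (simp add: point_mass_inject)
qed

lemma continuous_on_translation:
  assumes z: "z \<in> Z"
  shows "continuous_on UNIV (translation z)"
proof -
  have "open (translation z -` U)" if U: "open U" for U
  proof -
    let ?S = "{C. compact C \<and> C \<noteq> {} \<and> C \<inter> U \<noteq> {} \<and> C \<subseteq> UNIV}"
    let ?supp = "\<lambda>p. supp (conv (point_mass (fst p)) (point_mass (snd p)))"
    have "openin michael_topology ?S"
      unfolding michael_topology_def
      by (rule topology_generated_by_Basis) (use U open_UNIV in blast)
    from openin_continuous_map_preimage[OF supp_continuous this]
    have "open {p. ?supp p \<in> ?S}"
      by (simp add: case_prod_unfold)
    then have "open ((\<lambda>x. (x, z)) -` {p. ?supp p \<in> ?S})"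
      by (rule open_vimage) (intro continuous_intros)
    then show ?thesis by (simp add: supp_conv_center[OF z] vimage_def)
  qed
  then show ?thesis by (simp add: continuous_on_open_vimage)
qed

lemma homeomorphism_translation:
  assumes z: "z \<in> Z"
  shows "homeomorphism UNIV UNIV (translation z) (translation (invol z))"
proof (rule homeomorphismI)
  show "translation z (translation (invol z) y) = y" for y
    using translation_invol[OF invol_center[OF z], of y] by (simp add: invol_invol)
qed (use z in \<open>simp_all add: continuous_on_translation invol_center translation_invol\<close>)

lemma measurable_translation:
  assumes "z \<in> Z"
  shows "translation z \<in> borel \<rightarrow>\<^sub>M borel"
  by (rule borel_measurable_continuous_onI[OF continuous_on_translation[OF assms]])

lemma hg_eval_center:
  assumes "z \<in> Z" and "f \<in> borel_measurable borel"
  shows "hg_eval conv f x z = f (translation z x)"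
  unfolding hg_eval_def conv_center[OF assms(1)] to_measure_point_mass
  using assms(2) by (rule integral_return[rotated]) simp

lemma disjoint_translate_iff:
  assumes "z \<in> Z"
  shows "E \<inter> hg_set_mult conv E {z} = {} \<longleftrightarrow> (\<forall>x\<in>E. translation z x \<notin> E)"
  by (auto simp: hg_set_mult_def supp_conv_center[OF assms])

lemma aperiodic_eventually_translate_notin:
  assumes aper: "aperiodic conv invol e m a" and center: "range a \<subseteq> Z"
    and E: "compact E" "emeasure m E > 0"
  shows "\<forall>\<^sub>F n::nat in sequentially. \<forall>x\<in>E.
    translation (a (int n)) x \<notin> E \<and> translation (invol (a (int n))) x \<notin> E"
proof -
  obtain N where N: "\<And>n::nat. n \<ge> N \<Longrightarrow>
      E \<inter> hg_set_mult conv E {a (int n)} = {} \<and> E \<inter> hg_set_mult conv E {a (- int n)} = {}"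
    using aper E unfolding aperiodic_def by blast
  have "a k \<in> Z" for k using center by blast
  moreover have "a (- int n) = invol (a (int n))" for n
    using aper by (simp add: aperiodic_def)
  ultimately show ?thesis
    using N unfolding eventually_sequentially by (metis disjoint_translate_iff)
qed

lemma Lambda_center:
  assumes aper: "aperiodic conv invol e m a" and center: "range a \<subseteq> Z"
    and w: "w \<in> borel_measurable borel" and f: "f \<in> borel_measurable borel"
  shows "Lambda conv w a n f x =
    complex_of_real (weight_prod conv invol w a n x) * f (translation (invol (a (int n))) x)"
proof -
  have "invol (a (int j)) \<in> Z" for j
    using center by (intro invol_center) auto
  moreover have "a (- int j) = invol (a (int j))" for j :: nat
    using aper by (simp add: aperiodic_def)
  ultimately show ?thesis
    using w f by (simp add: Lambda_def weight_prod_def hg_eval_center)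
qed

lemma distr_right_haar_measure_translation:
  assumes haar: "right_haar_measure conv m" and z: "z \<in> Z"
  shows "distr m borel (translation z) = m"
proof (rule radon_measure_eqI_Cc[OF locally_compact])
  show rad: "radon_measure m" using haar by (simp add: right_haar_measure_def)
  show "radon_measure (distr m borel (translation z))"
    by (rule radon_measure_distr_homeomorphism[OF rad homeomorphism_translation[OF z]])
  have [measurable_cong]: "sets m = sets borel" by (rule sets_radon_measure) fact
  fix f :: "'a \<Rightarrow> real" assume "f \<in> Cc"
  then have f: "f \<in> borel_measurable borel" "(\<lambda>x. complex_of_real (f x)) \<in> Cc"
    by (auto simp: borel_measurable_Cc) (auto simp: Cc_def intro: continuous_intros)
  have [measurable]: "translation z \<in> borel \<rightarrow>\<^sub>M borel" by (rule measurable_translation) fact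
  have "(LINT x|distr m borel (translation z). f x) = (LINT x|m. f (translation z x))"
    using f by (intro integral_distr) measurable
  also have "complex_of_real \<dots> = (LINT x|m. hg_eval conv (\<lambda>x. complex_of_real (f x)) x z)"
    using f z by (simp add: hg_eval_center)
  also have "\<dots> = (LINT x|m. complex_of_real (f x))"
    using haar f(2) by (simp add: right_haar_measure_def)
  finally show "(LINT x|distr m borel (translation z). f x) = (LINT x|m. f x)"
    by simp
qed

end

section \<open>Young functions\<close>

lemma e2ennreal_le_iff: "e2ennreal s \<le> c \<longleftrightarrow> s \<le> enn2ereal c"
proof (cases "0 \<le> s")
  case True
  then show ?thesis by (simp add: less_eq_ennreal.rep_eq enn2ereal_e2ennreal)
next
  case False
  then have "s \<le> 0" by simp
  then have "s \<le> enn2ereal c" by (rule order_trans) simp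
  with \<open>s \<le> 0\<close> show ?thesis by (simp add: e2ennreal_neg)
qed

lemma complementary_le_iff:
  "complementary \<Phi> y \<le> c \<longleftrightarrow> (\<forall>x\<ge>0. ennreal (x * y) \<le> \<Phi> x + c)"
proof -
  have "ereal (x * y) - enn2ereal (\<Phi> x) \<le> enn2ereal c \<longleftrightarrow> ennreal (x * y) \<le> \<Phi> x + c" for x
    by (cases "\<Phi> x"; cases c)
      (auto simp: enn2ereal_ennreal ennreal_plus[symmetric] ennreal_le_iff simp del: ennreal_plus)
  then show ?thesis
    by (simp add: complementary_def e2ennreal_le_iff SUP_le_iff Ball_def)
qed

lemma young_inequality: "0 \<le> x \<Longrightarrow> ennreal (x * y) \<le> \<Phi> x + complementary \<Phi> y"
  using complementary_le_iff[of \<Phi> y "complementary \<Phi> y"] by simp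

lemma mono_complementary: "mono (complementary \<Phi>)"
proof (rule monoI)
  fix y z :: real assume "y \<le> z"
  have "ennreal (x * y) \<le> \<Phi> x + complementary \<Phi> z" if "0 \<le> x" for x
  proof -
    have "ennreal (x * y) \<le> ennreal (x * z)"
      using that \<open>y \<le> z\<close> by (intro ennreal_leI mult_left_mono)
    also have "\<dots> \<le> \<Phi> x + complementary \<Phi> z" using that by (rule young_inequality)
    finally show ?thesis .
  qed
  then show "complementary \<Phi> y \<le> complementary \<Phi> z" by (simp add: complementary_le_iff)
qed

lemma young_function_scale_le:
  assumes "young_function \<Phi>" and "0 \<le> t" "t \<le> 1" and "0 \<le> x"
  shows "\<Phi> (t * x) \<le> ennreal t * \<Phi> x"
proof -
  have "\<Phi> (t * x + (1 - t) * 0) \<le> ennreal t * \<Phi> x + ennreal (1 - t) * \<Phi> 0"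
    using assms unfolding young_function_def by (meson atLeastAtMost_iff order_refl)
  moreover have "\<Phi> 0 = 0" using assms(1) by (simp add: young_function_def)
  ultimately show ?thesis by simp
qed

lemma young_function_mono:
  assumes "young_function \<Phi>" and "0 \<le> x" "x \<le> y"
  shows "\<Phi> x \<le> \<Phi> y"
proof (cases "y = 0")
  case False
  then have "\<Phi> (x / y * y) \<le> ennreal (x / y) * \<Phi> y"
    using assms by (intro young_function_scale_le) auto
  also have "\<dots> \<le> 1 * \<Phi> y"
    using assms False by (intro mult_right_mono) (auto simp: ennreal_le_1)
  finally show ?thesis using False by simp
qed (use assms in simp)

lemma young_function_linear_lower_bound:
  assumes young: "young_function \<Phi>"
  obtains b where "0 < b" and "\<And>x. b \<le> x \<Longrightarrow> ennreal (x / b) \<le> \<Phi> x"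
proof -
  have "(\<Phi> \<longlongrightarrow> \<infinity>) at_top" using young by (simp add: young_function_def)
  then have "\<forall>\<^sub>F x in at_top. 1 < \<Phi> x" by (rule order_tendstoD) simp
  then have "\<forall>\<^sub>F x in at_top. 0 < x \<and> 1 < \<Phi> x"
    using eventually_gt_at_top by (rule eventually_conj[rotated])
  from eventually_happens'[OF _ this] obtain b where b: "0 < b" "1 < \<Phi> b"
    by auto
  have "ennreal (x / b) \<le> \<Phi> x" if "b \<le> x" for x
  proof -
    have x: "0 < x" using that b(1) by simp
    have "ennreal (x / b) * 1 \<le> ennreal (x / b) * \<Phi> (b / x * x)"
      using x b(2) by (intro mult_left_mono) auto
    also have "\<dots> \<le> ennreal (x / b) * (ennreal (b / x) * \<Phi> x)"
      using x b(1) that by (intro mult_left_mono young_function_scale_le[OF young]) auto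
    also have "\<dots> = ennreal (x / b * (b / x)) * \<Phi> x"
      using x b(1) by (subst ennreal_mult) (auto simp: mult.assoc)
    also have "\<dots> = \<Phi> x" using x b(1) by simp
    finally show ?thesis by simp
  qed
  with b(1) show thesis by (rule that)
qed

lemma complementary_linear_bound:
  assumes young: "young_function \<Phi>"
  obtains b where "0 < b" and "\<And>y. \<lbrakk>0 \<le> y; y \<le> 1 / b\<rbrakk> \<Longrightarrow> complementary \<Phi> y \<le> ennreal (b * y)"
proof -
  obtain b where b: "0 < b" "\<And>x. b \<le> x \<Longrightarrow> ennreal (x / b) \<le> \<Phi> x"
    by (rule young_function_linear_lower_bound[OF young]) blast
  have "complementary \<Phi> y \<le> ennreal (b * y)" if y: "0 \<le> y" "y \<le> 1 / b" for y
    unfolding complementary_le_iff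
  proof (intro allI impI)
    fix x :: real assume x: "0 \<le> x"
    show "ennreal (x * y) \<le> \<Phi> x + ennreal (b * y)"
    proof (cases "b \<le> x")
      case True
      have "ennreal (x * y) \<le> ennreal (x / b)"
        using x y mult_left_mono[of y "1 / b" x] by (intro ennreal_leI) simp
      also have "\<dots> \<le> \<Phi> x" by (rule b(2)) fact
      finally show ?thesis by (rule add_increasing2[rotated]) simp
    next
      case False
      then have "ennreal (x * y) \<le> ennreal (b * y)"
        using y by (intro ennreal_leI mult_right_mono) auto
      then show ?thesis by (rule add_increasing[rotated]) simp
    qed
  qed
  with b(1) show thesis by (rule that)
qed

lemma increasing_complementary_finite_value:
  assumes inc: "increasing_complementary \<Phi>" and "\<Phi> 0 = 0"
  shows "\<exists>x>0. \<Phi> x < \<infinity>"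
proof (rule ccontr)
  assume "\<not> (\<exists>x>0. \<Phi> x < \<infinity>)"
  then have "\<Phi> x = \<infinity>" if "0 < x" for x
    using that by (metis infinity_ennreal_def top.not_eq_extremum)
  then have "ennreal (x * y) \<le> \<Phi> x + 0" if "0 \<le> x" for x y
    using that by (cases "x = 0") auto
  then have "complementary \<Phi> y \<le> 0" for y
    by (subst complementary_le_iff) simp
  then have "complementary \<Phi> constant_on {0..}" by (auto simp: constant_on_def)
  with inc show False by (simp add: increasing_complementary_def)
qed

lemma borel_measurable_mono_second_countable:
  fixes f :: "real \<Rightarrow> 'b::{second_countable_topology,linorder_topology}"
  assumes "mono f"
  shows "f \<in> borel_measurable borel"
proof (rule borel_measurableI_greater)
  fix b
  have "is_interval {y. b < f y}"
    using assms by (auto simp: is_interval_1 intro: less_le_trans dest: monoD)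
  then show "{y \<in> space borel. b < f y} \<in> sets borel"
    using real_interval_borel_measurable by simp
qed

lemma borel_measurable_complementary [measurable]: "complementary \<Phi> \<in> borel_measurable borel"
  by (rule borel_measurable_mono_second_countable[OF mono_complementary])

lemma borel_measurable_young_function:
  assumes young: "young_function \<Phi>" and f: "f \<in> borel_measurable M" "\<And>x. 0 \<le> f x"
  shows "(\<lambda>x. \<Phi> (f x)) \<in> borel_measurable M"
proof -
  have "mono (\<lambda>x. \<Phi> (max 0 x))"
    using young_function_mono[OF young] by (auto simp: mono_def)
  then have "(\<lambda>x. \<Phi> (max 0 x)) \<in> borel_measurable borel"
    by (rule borel_measurable_mono_second_countable)
  from measurable_compose[OF f(1) this] show ?thesis using f(2) by (simp add: max_absorb2)
qed

section \<open>The Orlicz norm\<close>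

definition complementary_ball ::
  "(real \<Rightarrow> ennreal) \<Rightarrow> 'a::topological_space measure \<Rightarrow> ('a \<Rightarrow> complex) set" where
  "complementary_ball \<Phi> m =
    {v \<in> borel_measurable borel. (\<integral>\<^sup>+x. complementary \<Phi> (cmod (v x)) \<partial>m) \<le> 1}"

lemma orlicz_norm_eq:
  "orlicz_norm \<Phi> m f = (SUP v\<in>complementary_ball \<Phi> m. \<integral>\<^sup>+x. ennreal (cmod (f x * v x)) \<partial>m)"
  by (simp add: orlicz_norm_def complementary_ball_def)

lemma nn_integral_le_orlicz_norm:
  "v \<in> complementary_ball \<Phi> m \<Longrightarrow> (\<integral>\<^sup>+x. ennreal (cmod (f x * v x)) \<partial>m) \<le> orlicz_norm \<Phi> m f"
  unfolding orlicz_norm_eq by (rule SUP_upper)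

lemma orlicz_norm_leI:
  assumes "\<And>v. v \<in> complementary_ball \<Phi> m \<Longrightarrow> (\<integral>\<^sup>+x. ennreal (cmod (f x * v x)) \<partial>m) \<le> c"
  shows "orlicz_norm \<Phi> m f \<le> c"
  unfolding orlicz_norm_eq using assms by (rule SUP_least)

lemma orlicz_norm_mono:
  assumes "\<And>x. cmod (f x) \<le> cmod (g x)"
  shows "orlicz_norm \<Phi> m f \<le> orlicz_norm \<Phi> m g"
  unfolding orlicz_norm_eq
  by (intro SUP_mono' nn_integral_mono ennreal_leI) (simp add: norm_mult mult_right_mono assms)

lemma orlicz_norm_cong:
  assumes "\<And>x. cmod (f x) = cmod (g x)"
  shows "orlicz_norm \<Phi> m f = orlicz_norm \<Phi> m g"
  by (intro antisym orlicz_norm_mono) (simp_all add: assms)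

lemma orlicz_norm_cmult:
  assumes [measurable_cong]: "sets m = sets borel" and [measurable]: "f \<in> borel_measurable borel"
  shows "orlicz_norm \<Phi> m (\<lambda>x. c * f x) = ennreal (cmod c) * orlicz_norm \<Phi> m f"
proof -
  have "(\<integral>\<^sup>+x. ennreal (cmod (c * f x * v x)) \<partial>m) =
      ennreal (cmod c) * (\<integral>\<^sup>+x. ennreal (cmod (f x * v x)) \<partial>m)"
    if [measurable]: "v \<in> borel_measurable borel" for v
    by (subst nn_integral_cmult[symmetric]) (auto simp: norm_mult ennreal_mult' mult.assoc)
  then show ?thesis
    unfolding orlicz_norm_eq SUP_mult_left_ennreal
    by (intro SUP_cong) (auto simp: complementary_ball_def)
qed

lemma orlicz_norm_add_le:
  assumes [measurable_cong]: "sets m = sets borel"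
    and [measurable]: "f \<in> borel_measurable borel" "g \<in> borel_measurable borel"
  shows "orlicz_norm \<Phi> m (\<lambda>x. f x + g x) \<le> orlicz_norm \<Phi> m f + orlicz_norm \<Phi> m g"
proof (rule orlicz_norm_leI)
  fix v assume v: "v \<in> complementary_ball \<Phi> m"
  then have [measurable]: "v \<in> borel_measurable borel" by (simp add: complementary_ball_def)
  have "(\<integral>\<^sup>+x. ennreal (cmod ((f x + g x) * v x)) \<partial>m) \<le>
      (\<integral>\<^sup>+x. ennreal (cmod (f x * v x)) + ennreal (cmod (g x * v x)) \<partial>m)"
    by (rule nn_integral_mono)
      (simp add: ennreal_plus[symmetric] distrib_right norm_triangle_ineq del: ennreal_plus)
  also have "\<dots> = (\<integral>\<^sup>+x. ennreal (cmod (f x * v x)) \<partial>m) + (\<integral>\<^sup>+x. ennreal (cmod (g x * v x)) \<partial>m)"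
    by (rule nn_integral_add) measurable
  also have "\<dots> \<le> orlicz_norm \<Phi> m f + orlicz_norm \<Phi> m g"
    by (intro add_mono nn_integral_le_orlicz_norm v)
  finally show "(\<integral>\<^sup>+x. ennreal (cmod ((f x + g x) * v x)) \<partial>m) \<le>
      orlicz_norm \<Phi> m f + orlicz_norm \<Phi> m g" .
qed

lemma orlicz_norm_indicator_le:
  assumes "sets m = sets borel" and "A \<in> sets borel" and "0 \<le> \<epsilon>"
    and "\<And>x. x \<in> A \<Longrightarrow> \<epsilon> \<le> cmod (f x)"
  shows "ennreal \<epsilon> * orlicz_norm \<Phi> m (indicator A) \<le> orlicz_norm \<Phi> m f"
proof -
  have "ennreal \<epsilon> * orlicz_norm \<Phi> m (indicator A) =
      orlicz_norm \<Phi> m (\<lambda>x. complex_of_real \<epsilon> * indicator A x)"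
    using assms by (subst orlicz_norm_cmult) auto
  also have "\<dots> \<le> orlicz_norm \<Phi> m f"
    using assms by (intro orlicz_norm_mono) (auto simp: indicator_def)
  finally show ?thesis .
qed

lemma orlicz_norm_sum_le:
  assumes "sets m = sets borel" and "finite I" and "\<And>i. i \<in> I \<Longrightarrow> f i \<in> borel_measurable borel"
  shows "orlicz_norm \<Phi> m (\<lambda>x. \<Sum>i\<in>I. f i x) \<le> (\<Sum>i\<in>I. orlicz_norm \<Phi> m (f i))"
  using assms(2,3)
proof (induction I)
  case empty
  have "orlicz_norm \<Phi> m (\<lambda>x. 0) \<le> 0" by (rule orlicz_norm_leI) simp
  then show ?case by simp
next
  case (insert i I)
  have "orlicz_norm \<Phi> m (\<lambda>x. f i x + (\<Sum>i\<in>I. f i x)) \<le>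
      orlicz_norm \<Phi> m (f i) + orlicz_norm \<Phi> m (\<lambda>x. \<Sum>i\<in>I. f i x)"
    using insert.prems by (intro orlicz_norm_add_le assms(1)) auto
  also have "\<dots> \<le> orlicz_norm \<Phi> m (f i) + (\<Sum>i\<in>I. orlicz_norm \<Phi> m (f i))"
    using insert by (intro add_left_mono) auto
  finally show ?case using insert.hyps by simp
qed

lemma orlicz_small_off_small_set:
  assumes sets: "sets m = sets borel" and G: "finite G" "G \<subseteq> borel_measurable borel"
    and small: "\<And>g. g \<in> G \<Longrightarrow> orlicz_norm \<Phi> m g \<le> ennreal (\<epsilon> * \<epsilon>)" and \<epsilon>: "0 < \<epsilon>"
    and E: "E \<in> sets borel"
  obtains F where "F \<in> sets borel" and "F \<subseteq> E"
    and "orlicz_norm \<Phi> m (indicator (E - F)) \<le> ennreal (real (card G) * \<epsilon>)"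
    and "\<forall>g\<in>G. \<forall>x\<in>F. cmod (g x) < \<epsilon>"
proof -
  define B where "B = (\<Union>g\<in>G. {x. \<epsilon> \<le> cmod (g x)})"
  have B: "B \<in> sets borel"
    unfolding B_def using G
    by (intro sets.finite_UN) (auto intro!: borel_measurable_le simp: pred_def[symmetric])
  have "ennreal \<epsilon> * orlicz_norm \<Phi> m (indicator (E - (E - B))) \<le>
      orlicz_norm \<Phi> m (\<lambda>x. \<Sum>g\<in>G. complex_of_real (cmod (g x)))"
  proof (rule orlicz_norm_indicator_le)
    fix x assume "x \<in> E - (E - B)"
    then obtain g where "g \<in> G" and "\<epsilon> \<le> cmod (g x)" by (auto simp: B_def)
    note this(2)
    also have "cmod (g x) \<le> (\<Sum>g\<in>G. cmod (g x))"
      using G(1) \<open>g \<in> G\<close> by (intro member_le_sum) auto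
    finally show "\<epsilon> \<le> cmod (\<Sum>g\<in>G. complex_of_real (cmod (g x)))"
      by (simp flip: of_real_sum)
  qed (use sets E B \<epsilon> in auto)
  also have "\<dots> \<le> (\<Sum>g\<in>G. orlicz_norm \<Phi> m (\<lambda>x. complex_of_real (cmod (g x))))"
    using G by (intro orlicz_norm_sum_le sets) auto
  also have "\<dots> = (\<Sum>g\<in>G. orlicz_norm \<Phi> m g)"
    by (intro sum.cong orlicz_norm_cong) auto
  also have "\<dots> \<le> of_nat (card G) * ennreal (\<epsilon> * \<epsilon>)"
    using small by (rule sum_bounded_above)
  also have "\<dots> = ennreal \<epsilon> * ennreal (real (card G) * \<epsilon>)"
    using \<epsilon> by (simp add: ennreal_of_nat_eq_real_of_nat ennreal_mult[symmetric] mult.left_commute)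
  finally have "orlicz_norm \<Phi> m (indicator (E - (E - B))) \<le> ennreal (real (card G) * \<epsilon>)"
    using \<epsilon> by (simp add: ennreal_mult_le_mult_iff)
  with E B show thesis
    by (intro that[of "E - B"]) (auto simp: B_def not_le)
qed

lemma orlicz_norm_compose_le:
  assumes [measurable_cong]: "sets m = sets borel"
    and [measurable]: "T \<in> borel \<rightarrow>\<^sub>M borel" "S \<in> borel \<rightarrow>\<^sub>M borel"
    and T: "distr m borel T = m" and inv: "\<And>x. S (T x) = x"
    and [measurable]: "f \<in> borel_measurable borel"
  shows "orlicz_norm \<Phi> m (\<lambda>x. f (T x)) \<le> orlicz_norm \<Phi> m f"
proof (rule orlicz_norm_leI)
  fix v assume v: "v \<in> complementary_ball \<Phi> m"
  then have [measurable]: "v \<in> borel_measurable borel" by (simp add: complementary_ball_def)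
  have nn_integral_T: "(\<integral>\<^sup>+x. g (T x) \<partial>m) = (\<integral>\<^sup>+x. g x \<partial>m)"
    if [measurable]: "g \<in> borel_measurable borel" for g :: "'a \<Rightarrow> ennreal"
    using nn_integral_distr[of T m borel g] by (simp add: T)
  have "(\<integral>\<^sup>+x. complementary \<Phi> (cmod (v (S x))) \<partial>m) = (\<integral>\<^sup>+x. complementary \<Phi> (cmod (v x)) \<partial>m)"
    by (subst nn_integral_T[symmetric]) (simp_all add: inv)
  then have vS: "(\<lambda>x. v (S x)) \<in> complementary_ball \<Phi> m"
    using v by (simp add: complementary_ball_def)
  have "(\<integral>\<^sup>+x. ennreal (cmod (f (T x) * v x)) \<partial>m) = (\<integral>\<^sup>+x. ennreal (cmod (f x * v (S x))) \<partial>m)"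
    by (subst nn_integral_T[symmetric]) (simp_all add: inv)
  also have "\<dots> \<le> orlicz_norm \<Phi> m f"
    by (rule nn_integral_le_orlicz_norm[OF vS])
  finally show "(\<integral>\<^sup>+x. ennreal (cmod (f (T x) * v x)) \<partial>m) \<le> orlicz_norm \<Phi> m f" .
qed

lemma orlicz_norm_finite:
  assumes young: "young_function \<Phi>" and [measurable_cong]: "sets m = sets borel"
    and f: "f \<in> orlicz_space \<Phi> m"
  shows "orlicz_norm \<Phi> m f < \<infinity>"
proof -
  obtain \<alpha> where \<alpha>: "0 < \<alpha>" "(\<integral>\<^sup>+x. \<Phi> (\<alpha> * cmod (f x)) \<partial>m) < \<infinity>"
    and [measurable]: "f \<in> borel_measurable borel"
    using f by (auto simp: orlicz_space_def)
  have [measurable]: "(\<lambda>x. \<Phi> (\<alpha> * cmod (f x))) \<in> borel_measurable m"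
    using \<alpha>(1) by (intro borel_measurable_young_function[OF young]) auto
  let ?K = "ennreal (1 / \<alpha>) * ((\<integral>\<^sup>+x. \<Phi> (\<alpha> * cmod (f x)) \<partial>m) + 1)"
  have "orlicz_norm \<Phi> m f \<le> ?K"
  proof (rule orlicz_norm_leI)
    fix v assume v: "v \<in> complementary_ball \<Phi> m"
    then have [measurable]: "v \<in> borel_measurable borel" by (simp add: complementary_ball_def)
    have "ennreal (cmod (f x * v x)) \<le>
        ennreal (1 / \<alpha>) * (\<Phi> (\<alpha> * cmod (f x)) + complementary \<Phi> (cmod (v x)))" for x
    proof -
      have "ennreal (cmod (f x * v x)) = ennreal (1 / \<alpha>) * ennreal (\<alpha> * cmod (f x) * cmod (v x))"
        using \<alpha>(1) by (subst ennreal_mult[symmetric]) (auto simp: norm_mult)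
      also have "\<dots> \<le> ennreal (1 / \<alpha>) * (\<Phi> (\<alpha> * cmod (f x)) + complementary \<Phi> (cmod (v x)))"
        using \<alpha>(1) by (intro mult_left_mono young_inequality) auto
      finally show ?thesis .
    qed
    then have "(\<integral>\<^sup>+x. ennreal (cmod (f x * v x)) \<partial>m) \<le>
        (\<integral>\<^sup>+x. ennreal (1 / \<alpha>) * (\<Phi> (\<alpha> * cmod (f x)) + complementary \<Phi> (cmod (v x))) \<partial>m)"
      by (rule nn_integral_mono)
    also have "\<dots> = ennreal (1 / \<alpha>) *
        ((\<integral>\<^sup>+x. \<Phi> (\<alpha> * cmod (f x)) \<partial>m) + (\<integral>\<^sup>+x. complementary \<Phi> (cmod (v x)) \<partial>m))"
      by (subst nn_integral_cmult, measurable) (subst nn_integral_add, measurable)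
    also have "\<dots> \<le> ?K"
      using v by (intro mult_left_mono add_left_mono) (auto simp: complementary_ball_def)
    finally show "(\<integral>\<^sup>+x. ennreal (cmod (f x * v x)) \<partial>m) \<le> ?K" .
  qed
  also have "?K < \<infinity>" using \<alpha>(2) by (simp add: ennreal_mult_less_top)
  finally show ?thesis .
qed

lemma orlicz_space_cmult:
  assumes "f \<in> orlicz_space \<Phi> m" and "c \<noteq> 0"
  shows "(\<lambda>x. c * f x) \<in> orlicz_space \<Phi> m"
proof -
  obtain \<alpha> where "0 < \<alpha>" "(\<integral>\<^sup>+x. \<Phi> (\<alpha> * cmod (f x)) \<partial>m) < \<infinity>"
    and "f \<in> borel_measurable borel"
    using assms(1) by (auto simp: orlicz_space_def)
  with \<open>c \<noteq> 0\<close> show ?thesis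
    by (auto simp: orlicz_space_def norm_mult intro!: exI[of _ "\<alpha> / cmod c"])
qed

lemma indicator_in_orlicz_space:
  assumes inc: "increasing_complementary \<Phi>" and "\<Phi> 0 = 0"
    and sets: "sets m = sets borel" and E: "E \<in> sets borel" "emeasure m E < \<infinity>"
  shows "indicator E \<in> orlicz_space \<Phi> m"
proof -
  obtain x where x: "0 < x" "\<Phi> x < \<infinity>"
    using increasing_complementary_finite_value[OF inc \<open>\<Phi> 0 = 0\<close>] by blast
  have "(\<integral>\<^sup>+y. \<Phi> (x * cmod (indicator E y)) \<partial>m) = (\<integral>\<^sup>+y. \<Phi> x * indicator E y \<partial>m)"
    using \<open>\<Phi> 0 = 0\<close> by (intro nn_integral_cong) (auto simp: indicator_def)
  also have "\<dots> < \<infinity>"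
    using E sets x by (simp add: nn_integral_cmult_indicator ennreal_mult_less_top)
  finally show ?thesis
    using E x by (auto simp: orlicz_space_def)
qed

lemma orlicz_norm_indicator_pos:
  assumes young: "young_function \<Phi>" and sets: "sets m = sets borel"
    and E: "E \<in> sets borel" "emeasure m E < \<infinity>" "emeasure m E > 0"
  shows "orlicz_norm \<Phi> m (indicator E) > 0"
proof -
  obtain b where b: "0 < b"
    and linear: "\<And>y. \<lbrakk>0 \<le> y; y \<le> 1 / b\<rbrakk> \<Longrightarrow> complementary \<Phi> y \<le> ennreal (b * y)"
    by (rule complementary_linear_bound[OF young]) blast
  obtain k where k: "emeasure m E = ennreal k" "0 < k"
    using E(2,3) by (cases "emeasure m E") auto
  define y where "y = min (1 / b) (1 / (b * k))"
  have y: "0 < y" "y \<le> 1 / b" "b * y * k \<le> 1"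
    using b k(2) by (auto simp: y_def min_def field_simps)
  let ?v = "\<lambda>x. complex_of_real y * indicator E x"
  have "(\<integral>\<^sup>+x. complementary \<Phi> (cmod (?v x)) \<partial>m) \<le> (\<integral>\<^sup>+x. ennreal (b * y) * indicator E x \<partial>m)"
    using y linear[of y] linear[of 0] b by (intro nn_integral_mono) (auto simp: indicator_def)
  also have "\<dots> = ennreal (b * y * k)"
    using E(1) sets b y(1) k by (simp add: nn_integral_cmult_indicator ennreal_mult)
  also have "\<dots> \<le> 1" using y(3) by (simp add: ennreal_le_1)
  finally have "?v \<in> complementary_ball \<Phi> m"
    using E(1) by (simp add: complementary_ball_def)
  then have "(\<integral>\<^sup>+x. ennreal (cmod (indicator E x * ?v x)) \<partial>m) \<le> orlicz_norm \<Phi> m (indicator E)"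
    by (rule nn_integral_le_orlicz_norm)
  moreover have "(\<integral>\<^sup>+x. ennreal (cmod (indicator E x * ?v x)) \<partial>m) =
      (\<integral>\<^sup>+x. ennreal y * indicator E x \<partial>m)"
    using y(1) by (intro nn_integral_cong) (auto simp: indicator_def)
  moreover have "\<dots> = ennreal (y * k)"
    using E(1) sets y(1) k by (simp add: nn_integral_cmult_indicator ennreal_mult)
  moreover have "0 < ennreal (y * k)" using y(1) k(2) by simp
  ultimately show ?thesis by (metis order.strict_trans2)
qed

subsection \<open>Dense sets\<close>

abbreviation orlicz_dist ::
  "(real \<Rightarrow> ennreal) \<Rightarrow> 'a::topological_space measure \<Rightarrow>
   ('a \<Rightarrow> complex) \<Rightarrow> ('a \<Rightarrow> complex) \<Rightarrow> ennreal" where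
  "orlicz_dist \<Phi> m f g \<equiv> orlicz_norm \<Phi> m (\<lambda>x. f x - g x)"

lemma orlicz_dist_commute: "orlicz_dist \<Phi> m f g = orlicz_dist \<Phi> m g f"
  by (rule orlicz_norm_cong) (rule norm_minus_commute)

lemma orlicz_dist_triangle:
  assumes "sets m = sets borel" and "f \<in> borel_measurable borel" "g \<in> borel_measurable borel"
    "h \<in> borel_measurable borel"
  shows "orlicz_dist \<Phi> m f h \<le> orlicz_dist \<Phi> m f g + orlicz_dist \<Phi> m g h"
  using orlicz_norm_add_le[OF assms(1), of "\<lambda>x. f x - g x" "\<lambda>x. g x - h x"] assms by simp

lemma orlicz_dist_cmult:
  assumes "sets m = sets borel" and "u \<in> borel_measurable borel"
  shows "orlicz_dist \<Phi> m (\<lambda>x. c * u x) (\<lambda>x. d * u x) = ennreal (cmod (c - d)) * orlicz_norm \<Phi> m u"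
  using orlicz_norm_cmult[OF assms, of \<Phi> "c - d"] by (simp add: left_diff_distrib)

lemma orlicz_dist_multiple_unique:
  assumes sets: "sets m = sets borel" and g: "g \<in> borel_measurable borel"
    and u: "u \<in> borel_measurable borel" "orlicz_norm \<Phi> m u > 0"
    and dist: "orlicz_dist \<Phi> m g (\<lambda>x. c * u x) = 0" "orlicz_dist \<Phi> m g (\<lambda>x. d * u x) = 0"
  shows "c = d"
proof -
  have "orlicz_dist \<Phi> m (\<lambda>x. c * u x) (\<lambda>x. d * u x) \<le>
      orlicz_dist \<Phi> m (\<lambda>x. c * u x) g + orlicz_dist \<Phi> m g (\<lambda>x. d * u x)"
    using u(1) g by (intro orlicz_dist_triangle[OF sets]) auto
  also have "\<dots> = 0"
    using dist by (simp add: orlicz_dist_commute[of _ _ _ g])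
  finally show "c = d"
    using u(2) by (auto simp: orlicz_dist_cmult[OF sets u(1)])
qed

lemma orlicz_denseD:
  assumes "orlicz_dense \<Phi> m D" and "g \<in> orlicz_space \<Phi> m" and "0 < \<epsilon>"
  obtains f where "f \<in> D" and "f \<in> borel_measurable borel" and "orlicz_dist \<Phi> m f g < \<epsilon>"
proof -
  obtain f where "f \<in> D" "orlicz_dist \<Phi> m f g < \<epsilon>"
    using assms unfolding orlicz_dense_def by blast
  moreover from this(1) have "f \<in> borel_measurable borel"
    using assms(1) by (auto simp: orlicz_dense_def orlicz_space_def)
  ultimately show thesis using that by blast
qed

text \<open>Each \<open>g\<close> is at distance \<open>0\<close> from at most one multiple of \<open>u\<close>.\<close>

lemma ex_multiple_off_finite:
  assumes sets: "sets m = sets borel" and G: "finite G" "G \<subseteq> borel_measurable borel"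
    and u: "u \<in> borel_measurable borel" "orlicz_norm \<Phi> m u > 0" and "0 < \<eta>"
  shows "\<exists>t::real. 0 < t \<and> t < \<eta> \<and>
    (\<forall>g\<in>G. orlicz_dist \<Phi> m g (\<lambda>x. complex_of_real (1 + t) * u x) \<noteq> 0)"
proof -
  let ?T = "\<lambda>g. {t. orlicz_dist \<Phi> m g (\<lambda>x. complex_of_real (1 + t) * u x) = 0}"
  have "finite (?T g)" if "g \<in> G" for g
  proof -
    have "t = t'" if "t \<in> ?T g" "t' \<in> ?T g" for t t'
      using orlicz_dist_multiple_unique[OF sets _ u,
          of g "complex_of_real (1 + t)" "complex_of_real (1 + t')"]
        that G(2) \<open>g \<in> G\<close> by (auto simp del: of_real_add)
    then have "?T g \<subseteq> {t}" if "t \<in> ?T g" for t using that by blast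
    then show ?thesis by (cases "?T g = {}") (auto intro: finite_subset)
  qed
  then have "finite (\<Union>g\<in>G. ?T g)" using G(1) by blast
  moreover have "infinite {0<..<\<eta>}" using \<open>0 < \<eta>\<close> by (rule infinite_Ioo)
  ultimately have "infinite ({0<..<\<eta>} - (\<Union>g\<in>G. ?T g))" by (rule Diff_infinite_finite)
  then obtain t where "t \<in> {0<..<\<eta>} - (\<Union>g\<in>G. ?T g)" using infinite_imp_nonempty by blast
  then show ?thesis by auto
qed

lemma orlicz_dense_avoid_finite:
  assumes young: "young_function \<Phi>" and sets: "sets m = sets borel"
    and dense: "orlicz_dense \<Phi> m D" and G: "finite G"
    and u: "u \<in> orlicz_space \<Phi> m" "orlicz_norm \<Phi> m u > 0" and \<epsilon>: "0 < \<epsilon>"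
  obtains f where "f \<in> D" and "f \<notin> G" and "f \<in> borel_measurable borel"
    and "orlicz_dist \<Phi> m f u < ennreal \<epsilon>"
proof -
  let ?u = "\<lambda>t x. complex_of_real (1 + t) * u x"
  have u_borel: "u \<in> borel_measurable borel" using u(1) by (simp add: orlicz_space_def)
  obtain K where K: "orlicz_norm \<Phi> m u = ennreal K" "0 < K"
    using orlicz_norm_finite[OF young sets u(1)] u(2) by (cases "orlicz_norm \<Phi> m u") auto
  have "finite (G \<inter> D)" "G \<inter> D \<subseteq> borel_measurable borel" "0 < \<epsilon> / (2 * K)"
    using G dense \<epsilon> K(2) by (auto simp: orlicz_dense_def orlicz_space_def)
  from ex_multiple_off_finite[OF sets this(1,2) u_borel u(2) this(3)]
  obtain t where t: "0 < t" "t < \<epsilon> / (2 * K)"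
    and away: "\<forall>g\<in>G \<inter> D. orlicz_dist \<Phi> m g (?u t) \<noteq> 0" by blast
  define r where "r = Min (insert (ennreal (\<epsilon> / 2)) ((\<lambda>g. orlicz_dist \<Phi> m g (?u t)) ` (G \<inter> D)))"
  have r: "r \<le> ennreal (\<epsilon> / 2)" "\<And>g. g \<in> G \<inter> D \<Longrightarrow> r \<le> orlicz_dist \<Phi> m g (?u t)"
    unfolding r_def using G by (auto intro!: Min_le)
  have "0 < r"
    unfolding r_def using G \<epsilon> away by (subst Min_gr_iff) (auto simp: zero_less_iff_neq_zero)
  have "?u t \<in> orlicz_space \<Phi> m"
    using t(1) by (intro orlicz_space_cmult[OF u(1)]) (simp del: of_real_add add: of_real_eq_0_iff)
  from orlicz_denseD[OF dense this \<open>0 < r\<close>]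
  obtain f where f: "f \<in> D" "f \<in> borel_measurable borel" "orlicz_dist \<Phi> m f (?u t) < r" .
  have "f \<notin> G" using f(1,3) r(2)[of f] by auto
  have "orlicz_dist \<Phi> m f u \<le> orlicz_dist \<Phi> m f (?u t) + orlicz_dist \<Phi> m (?u t) u"
    using u_borel by (intro orlicz_dist_triangle[OF sets f(2)]) auto
  also have "orlicz_dist \<Phi> m (?u t) u = ennreal (t * K)"
    using orlicz_dist_cmult[OF sets u_borel, of \<Phi> "complex_of_real (1 + t)" 1] t(1) K
    by (simp add: ennreal_mult)
  also have "orlicz_dist \<Phi> m f (?u t) + ennreal (t * K) < ennreal (\<epsilon> / 2) + ennreal (\<epsilon> / 2)"
    using f(3) r(1) t(2) K(2) \<epsilon>
    by (intro add_strict_mono ennreal_lessI) (auto simp: field_simps)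
  also have "\<dots> = ennreal \<epsilon>" using \<epsilon> by (simp add: ennreal_plus[symmetric] del: ennreal_plus)
  finally show thesis using that f(1,2) \<open>f \<notin> G\<close> by blast
qed

section \<open>Hypercyclicity\<close>

lemma densely_hypercyclic_recurrence:
  assumes young: "young_function \<Phi>" and sets: "sets m = sets borel"
    and hyper: "densely_hypercyclic_weight conv m a \<Phi> w"
    and u: "u \<in> orlicz_space \<Phi> m" "orlicz_norm \<Phi> m u > 0" and \<epsilon>: "0 < \<epsilon>"
  obtains f n where "n > N"
    and "f \<in> borel_measurable borel" and "orlicz_dist \<Phi> m f u < ennreal \<epsilon>"
    and "Lambda conv w a n f \<in> borel_measurable borel"
    and "orlicz_dist \<Phi> m (Lambda conv w a n f) u < ennreal \<epsilon>"
proof -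
  have "orlicz_dense \<Phi> m {f. hypercyclic_vector conv m a \<Phi> w f}" and "0 < ennreal \<epsilon>"
    using hyper \<epsilon> by (simp_all add: densely_hypercyclic_weight_def)
  from orlicz_denseD[OF this(1) u(1) this(2)]
  obtain f where f: "f \<in> {f. hypercyclic_vector conv m a \<Phi> w f}" "f \<in> borel_measurable borel"
    "orlicz_dist \<Phi> m f u < ennreal \<epsilon>" .
  have dense: "orlicz_dense \<Phi> m (insert f {Lambda conv w a n f | n. n \<ge> 1})"
    using f(1) by (simp add: hypercyclic_vector_def)
  have "finite (insert f ((\<lambda>n. Lambda conv w a n f) ` {1..N}))" by simp
  from orlicz_dense_avoid_finite[OF young sets dense this u \<epsilon>]
  obtain h where h: "h \<in> insert f {Lambda conv w a n f | n. n \<ge> 1}"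
      "h \<notin> insert f ((\<lambda>n. Lambda conv w a n f) ` {1..N})"
      "h \<in> borel_measurable borel" "orlicz_dist \<Phi> m h u < ennreal \<epsilon>" .
  then obtain n where n: "h = Lambda conv w a n f" "n > N" by (auto simp: image_iff)
  show thesis by (rule that[OF n(2) f(2,3) h(3,4)[unfolded n(1)]])
qed

lemma norm_ge_half:
  fixes z :: complex
  assumes "cmod (z - 1) < 1 / 2"
  shows "1 / 2 < cmod z"
  using assms norm_triangle_ineq2[of 1 z] by (simp add: norm_minus_commute)

lemma weight_prod_pos: "hg_weight w \<Longrightarrow> 0 < weight_prod conv invol w a n x"
  by (simp add: weight_prod_def hg_weight_def prod_pos)

lemma borel_measurable_hg_weight: "hg_weight w \<Longrightarrow> w \<in> borel_measurable borel"
  by (simp add: hg_weight_def borel_measurable_continuous_onI)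

context hypergroup
begin

lemma weight_prod_bounds:
  assumes weight: "hg_weight w" and aper: "aperiodic conv invol e m a" and center: "range a \<subseteq> Z"
    and f: "f \<in> borel_measurable borel" and \<epsilon>: "\<epsilon> \<le> 1 / 2"
    and near_one: "cmod (f x - 1) < \<epsilon>" "cmod (Lambda conv w a n f x - 1) < \<epsilon>"
    and near_zero: "cmod (f (translation (invol (a (int n))) x)) < \<epsilon>"
      "cmod (Lambda conv w a n f (translation (a (int n)) x)) < \<epsilon>"
  shows "\<bar>1 / weight_prod conv invol w a n x\<bar> \<le> 2 * \<epsilon>"
    and "\<bar>weight_prod_shift conv invol w a n x\<bar> \<le> 2 * \<epsilon>"
proof -
  let ?v = "weight_prod conv invol w a n" and ?h = "weight_prod_shift conv invol w a n"
  note v_pos = weight_prod_pos[OF weight, of conv invol a n]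
  then have h_pos: "0 < ?h x" by (simp add: weight_prod_shift_def)
  note \<Lambda> = Lambda_center[OF aper center borel_measurable_hg_weight[OF weight] f]
  have "a (int n) \<in> Z" using center by blast
  then have \<Lambda>_shift:
    "Lambda conv w a n f (translation (a (int n)) x) = complex_of_real (?h x) * f x"
    by (simp add: \<Lambda> translation_invol weight_prod_shift_def)
  have "1 / 2 < cmod (Lambda conv w a n f x)"
    using near_one(2) \<epsilon> by (intro norm_ge_half) simp
  also have "\<dots> = ?v x * cmod (f (translation (invol (a (int n))) x))"
    using v_pos[of x] by (simp add: \<Lambda> norm_mult)
  also have "\<dots> \<le> ?v x * \<epsilon>"
    using v_pos[of x] near_zero(1) by (intro mult_left_mono) auto
  finally show "\<bar>1 / ?v x\<bar> \<le> 2 * \<epsilon>"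
    using v_pos[of x] by (simp add: field_simps)
  have "1 / 2 < cmod (f x)"
    using near_one(1) \<epsilon> by (intro norm_ge_half) simp
  then have "?h x * (1 / 2) \<le> ?h x * cmod (f x)"
    using h_pos by (intro mult_left_mono) auto
  also have "\<dots> < \<epsilon>"
    using near_zero(2) h_pos by (simp add: \<Lambda>_shift norm_mult)
  finally show "\<bar>?h x\<bar> \<le> 2 * \<epsilon>" using h_pos by simp
qed

lemma orlicz_norm_translation_le:
  assumes haar: "right_haar_measure conv m" and z: "z \<in> Z" and f: "f \<in> borel_measurable borel"
  shows "orlicz_norm \<Phi> m (\<lambda>x. f (translation z x)) \<le> orlicz_norm \<Phi> m f"
proof (rule orlicz_norm_compose_le[where S = "translation (invol z)"])
  show "sets m = sets borel"
    using haar by (simp add: right_haar_measure_def sets_radon_measure)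
  show "distr m borel (translation z) = m"
    by (rule distr_right_haar_measure_translation[OF haar z])
qed (use f z in \<open>simp_all add: measurable_translation invol_center translation_invol\<close>)

lemma near_indicator_off_small_set:
  assumes haar: "right_haar_measure conv m" and z: "z \<in> Z"
    and E: "E \<in> sets borel" "\<forall>x\<in>E. translation z x \<notin> E \<and> translation (invol z) x \<notin> E"
    and f: "f \<in> borel_measurable borel" "orlicz_dist \<Phi> m f (indicator E) \<le> ennreal (\<epsilon> * \<epsilon>)"
    and h: "h \<in> borel_measurable borel" "orlicz_dist \<Phi> m h (indicator E) \<le> ennreal (\<epsilon> * \<epsilon>)"
    and \<epsilon>: "0 < \<epsilon>"
  obtains F where "F \<in> sets borel" and "F \<subseteq> E"
    and "orlicz_norm \<Phi> m (indicator (E - F)) \<le> ennreal (4 * \<epsilon>)"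
    and "\<forall>x\<in>F. cmod (f x - 1) < \<epsilon> \<and> cmod (h x - 1) < \<epsilon> \<and>
      cmod (f (translation (invol z) x)) < \<epsilon> \<and> cmod (h (translation z x)) < \<epsilon>"
proof -
  have sets: "sets m = sets borel"
    using haar by (simp add: right_haar_measure_def sets_radon_measure)
  let ?f = "\<lambda>x. f x - indicator E x" and ?h = "\<lambda>x. h x - indicator E x"
  let ?G = "{?f, ?h, \<lambda>x. ?f (translation (invol z) x), \<lambda>x. ?h (translation z x)}"
  have fh: "?f \<in> borel_measurable borel" "?h \<in> borel_measurable borel" using f(1) h(1) E(1) by auto
  then have G: "finite ?G" "?G \<subseteq> borel_measurable borel"
    using z invol_center[OF z] by (auto intro: measurable_compose[OF measurable_translation])
  have "orlicz_norm \<Phi> m k \<le> ennreal (\<epsilon> * \<epsilon>)" if "k \<in> ?G" for k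
    using that f(2) h(2) orlicz_norm_translation_le[OF haar invol_center[OF z] fh(1), of \<Phi>]
      orlicz_norm_translation_le[OF haar z fh(2), of \<Phi>]
    by auto
  from orlicz_small_off_small_set[OF sets G this \<epsilon> E(1)]
  obtain F where F: "F \<in> sets borel" "F \<subseteq> E"
    "orlicz_norm \<Phi> m (indicator (E - F)) \<le> ennreal (real (card ?G) * \<epsilon>)"
    and small: "\<forall>k\<in>?G. \<forall>x\<in>F. cmod (k x) < \<epsilon>" .
  have "card ?G \<le> 4" by (simp add: card_insert_if)
  then have "ennreal (real (card ?G) * \<epsilon>) \<le> ennreal (4 * \<epsilon>)"
    using \<epsilon> by (intro ennreal_leI mult_right_mono) auto
  with F(3) have "orlicz_norm \<Phi> m (indicator (E - F)) \<le> ennreal (4 * \<epsilon>)" by (rule order_trans)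
  moreover have "cmod (f x - 1) < \<epsilon> \<and> cmod (h x - 1) < \<epsilon> \<and>
      cmod (f (translation (invol z) x)) < \<epsilon> \<and> cmod (h (translation z x)) < \<epsilon>" if "x \<in> F" for x
  proof -
    have "x \<in> E" "translation z x \<notin> E" "translation (invol z) x \<notin> E"
      using that F(2) E(2) by auto
    moreover have "cmod (?f x) < \<epsilon>" "cmod (?h x) < \<epsilon>"
      "cmod (?f (translation (invol z) x)) < \<epsilon>" "cmod (?h (translation z x)) < \<epsilon>"
      using small that by simp_all
    ultimately show ?thesis by simp
  qed
  ultimately show thesis using F(1,2) by (intro that) auto
qed

lemma hypercyclic_near_indicator:
  assumes young: "young_function \<Phi>" and inc: "increasing_complementary \<Phi>"
    and haar: "right_haar_measure conv m" and aper: "aperiodic conv invol e m a"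
    and center: "range a \<subseteq> Z" and hyper: "densely_hypercyclic_weight conv m a \<Phi> w"
    and E: "compact E" "emeasure m E > 0" and \<epsilon>: "0 < \<epsilon>"
  obtains n f F where "n > N" and "f \<in> borel_measurable borel"
    and "F \<in> sets borel" and "F \<subseteq> E"
    and "orlicz_norm \<Phi> m (indicator (E - F)) \<le> ennreal (4 * \<epsilon>)"
    and "\<forall>x\<in>F. cmod (f x - 1) < \<epsilon> \<and> cmod (Lambda conv w a n f x - 1) < \<epsilon> \<and>
      cmod (f (translation (invol (a (int n))) x)) < \<epsilon> \<and>
      cmod (Lambda conv w a n f (translation (a (int n)) x)) < \<epsilon>"
proof -
  have rad: "radon_measure m" using haar by (simp add: right_haar_measure_def)
  note sets = sets_radon_measure[OF rad]
  have E_borel: "E \<in> sets borel" using E(1) by (rule borel_compact)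
  have "emeasure m E < \<infinity>" by (rule emeasure_radon_measure_compact[OF rad E(1)])
  then have \<chi>: "indicator E \<in> orlicz_space \<Phi> m" "orlicz_norm \<Phi> m (indicator E) > 0"
    using young inc sets E_borel E(2)
    by (auto intro!: indicator_in_orlicz_space orlicz_norm_indicator_pos simp: young_function_def)
  obtain N' where disjoint: "\<forall>n\<ge>N'. \<forall>x\<in>E.
      translation (a (int n)) x \<notin> E \<and> translation (invol (a (int n))) x \<notin> E"
    using aperiodic_eventually_translate_notin[OF aper center E]
    unfolding eventually_sequentially by (elim exE)
  have "0 < \<epsilon> * \<epsilon>" using \<epsilon> by simp
  then obtain f n where n: "n > max N N'"
    and f: "f \<in> borel_measurable borel" "orlicz_dist \<Phi> m f (indicator E) < ennreal (\<epsilon> * \<epsilon>)"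
    and \<Lambda>: "Lambda conv w a n f \<in> borel_measurable borel"
      "orlicz_dist \<Phi> m (Lambda conv w a n f) (indicator E) < ennreal (\<epsilon> * \<epsilon>)"
    by (rule densely_hypercyclic_recurrence[OF young sets hyper \<chi>])
  have "a (int n) \<in> Z" using center by blast
  moreover have "\<forall>x\<in>E. translation (a (int n)) x \<notin> E \<and> translation (invol (a (int n))) x \<notin> E"
    using disjoint n by simp
  moreover have "n > N" using n by simp
  ultimately show thesis
    using near_indicator_off_small_set[OF haar _ E_borel _ f(1) less_imp_le[OF f(2)]
        \<Lambda>(1) less_imp_le[OF \<Lambda>(2)] \<epsilon>] that f(1) by metis
qed

definition approximating_set ::
  "(real \<Rightarrow> ennreal) \<Rightarrow> 'a measure \<Rightarrow> ('a \<Rightarrow> real) \<Rightarrow> (int \<Rightarrow> 'a) \<Rightarrow> 'a set \<Rightarrow>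
   real \<Rightarrow> nat \<Rightarrow> 'a set \<Rightarrow> bool"
where
  "approximating_set \<Phi> m w a E \<epsilon> n F \<longleftrightarrow>
    F \<in> sets borel \<and> F \<subseteq> E \<and> orlicz_norm \<Phi> m (indicator (E - F)) \<le> ennreal \<epsilon> \<and>
    sup_norm_on F (\<lambda>x. 1 / weight_prod conv invol w a n x) \<le> ennreal \<epsilon> \<and>
    sup_norm_on F (weight_prod_shift conv invol w a n) \<le> ennreal \<epsilon>"

lemma ex_approximating_set:
  assumes young: "young_function \<Phi>" and inc: "increasing_complementary \<Phi>"
    and haar: "right_haar_measure conv m" and weight: "hg_weight w"
    and aper: "aperiodic conv invol e m a" and center: "range a \<subseteq> Z"
    and hyper: "densely_hypercyclic_weight conv m a \<Phi> w"
    and E: "compact E" "emeasure m E > 0" and "0 < \<delta>"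
  shows "\<exists>n>N. \<exists>F. approximating_set \<Phi> m w a E \<delta> n F"
proof -
  define \<epsilon> where "\<epsilon> = min (\<delta> / 4) (1 / 2)"
  have \<epsilon>: "0 < \<epsilon>" "\<epsilon> \<le> 1 / 2" "4 * \<epsilon> \<le> \<delta>" using \<open>0 < \<delta>\<close> by (auto simp: \<epsilon>_def)
  obtain n f F where n: "n > N" and f: "f \<in> borel_measurable borel"
    and F: "F \<in> sets borel" "F \<subseteq> E" "orlicz_norm \<Phi> m (indicator (E - F)) \<le> ennreal (4 * \<epsilon>)"
    and near: "\<forall>x\<in>F. cmod (f x - 1) < \<epsilon> \<and> cmod (Lambda conv w a n f x - 1) < \<epsilon> \<and>
      cmod (f (translation (invol (a (int n))) x)) < \<epsilon> \<and>
      cmod (Lambda conv w a n f (translation (a (int n)) x)) < \<epsilon>"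
    by (rule hypercyclic_near_indicator[OF young inc haar aper center hyper E \<epsilon>(1)])
  have "\<bar>1 / weight_prod conv invol w a n x\<bar> \<le> 2 * \<epsilon> \<and>
      \<bar>weight_prod_shift conv invol w a n x\<bar> \<le> 2 * \<epsilon>" if "x \<in> F" for x
    using weight_prod_bounds[OF weight aper center f \<epsilon>(2)] near that by blast
  moreover have "2 * \<epsilon> \<le> \<delta>" using \<epsilon> by simp
  ultimately have "approximating_set \<Phi> m w a E \<delta> n F"
    unfolding approximating_set_def sup_norm_on_def
    using F \<epsilon>(3) by (blast intro: SUP_least ennreal_leI order_trans)
  then show ?thesis using n by auto
qed

end

lemma strict_mono_choice:
  fixes P :: "nat \<Rightarrow> nat \<Rightarrow> 'b \<Rightarrow> bool"
  assumes "\<And>k N. \<exists>n>N. \<exists>F. P k n F"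
  obtains n F where "strict_mono n" and "\<forall>k. n k \<ge> 1" and "\<forall>k. P k (n k) (F k)"
proof -
  have "\<exists>n. \<forall>k. (n k \<ge> 1 \<and> (\<exists>F. P k (n k) F)) \<and> n k < n (Suc k)"
  proof (rule dependent_nat_choice)
    show "\<exists>n. n \<ge> 1 \<and> (\<exists>F. P 0 n F)" using assms[of 0 0] by (auto simp: Suc_le_eq)
    show "\<exists>l. (l \<ge> 1 \<and> (\<exists>F. P (Suc k) l F)) \<and> n < l" for n k
      using assms[of n "Suc k"] by (metis One_nat_def Suc_leI le_less_trans zero_le)
  qed
  then obtain n where n: "\<forall>k. n k < n (Suc k)" "\<forall>k. n k \<ge> 1" and "\<forall>k. \<exists>F. P k (n k) F"
    by blast
  then obtain F where "\<forall>k. P k (n k) (F k)" by metis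
  moreover have "strict_mono n" using n(1) by (simp add: strict_mono_Suc_iff)
  ultimately show thesis using n(2) by (intro that)
qed

lemma tendsto_zero_ennreal_bound:
  fixes f :: "nat \<Rightarrow> ennreal"
  assumes "\<And>k. f k \<le> ennreal (b k)" and "b \<longlonglongrightarrow> 0"
  shows "f \<longlonglongrightarrow> 0"
proof (rule tendsto_sandwich)
  show "(\<lambda>_. 0) \<longlonglongrightarrow> (0::ennreal)" by simp
  show "(\<lambda>k. ennreal (b k)) \<longlonglongrightarrow> 0" using tendsto_ennrealI[OF assms(2)] by simp
qed (use assms(1) in auto)

theorem theorem2p20:
  fixes conv :: "('a::t2_space set \<Rightarrow> complex) \<Rightarrow> ('a set \<Rightarrow> complex) \<Rightarrow> 'a set \<Rightarrow> complex"
    and invol :: "'a \<Rightarrow> 'a" and e :: 'a and m :: "'a measure"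
    and \<Phi> :: "real \<Rightarrow> ennreal" and w :: "'a \<Rightarrow> real" and a :: "int \<Rightarrow> 'a" and E :: "'a set"
  assumes "young_function \<Phi>" and "increasing_complementary \<Phi>"
    and "hypergroup conv invol e" and "right_haar_measure conv m"
    and "hg_weight w"
    and "aperiodic conv invol e m a" and "range a \<subseteq> hg_center conv invol e"
    and "densely_hypercyclic_weight conv m a \<Phi> w"
    and "compact E" and "emeasure m E > 0"
  shows "\<exists>(F :: nat \<Rightarrow> 'a set) (n :: nat \<Rightarrow> nat).
           (\<forall>k. F k \<in> sets borel \<and> F k \<subseteq> E) \<and>
           strict_mono n \<and> (\<forall>k. n k \<ge> 1) \<and>
           (\<lambda>k. orlicz_norm \<Phi> m (indicator (E - F k))) \<longlonglongrightarrow> 0 \<and>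
           (\<lambda>k. sup_norm_on (F k) (\<lambda>x. 1 / weight_prod conv invol w a (n k) x)) \<longlonglongrightarrow> 0 \<and>
           (\<lambda>k. sup_norm_on (F k) (weight_prod_shift conv invol w a (n k))) \<longlonglongrightarrow> 0"
proof -
  interpret hypergroup conv invol e by fact
  let ?P = "\<lambda>k. approximating_set \<Phi> m w a E (inverse (real (Suc k)))"
  have "\<exists>n>N. \<exists>F. ?P k n F" for k N
    using assms by (intro ex_approximating_set) auto
  then obtain n F where n: "strict_mono n" "\<forall>k. n k \<ge> 1" and F: "\<forall>k. ?P k (n k) (F k)"
    by (rule strict_mono_choice[where P = ?P])
  note lim = tendsto_zero_ennreal_bound[OF _ LIMSEQ_inverse_real_of_nat]
  show ?thesis
    using n F unfolding approximating_set_def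
    by (intro exI[of _ F] exI[of _ n] conjI allI lim) blast+
qed

end
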